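(* Assume that a class of languages $\mathcal{C}$ satisfies the following closure property: if $L_1\subseteq\Sigma_1^*$ and $L_2\subseteq\Sigma_2^*$ are languages in the class $\mathcal{C}$ for which $\Sigma_1\cap\Sigma_2=\varnothing$, then the concatenation $L_1L_2$ is in the class $\mathcal{C}$. Then the direct product of two $\mathcal{C}$-Cayley p.f. linear-time computable groups is $\mathcal{C}$-Cayley p.f. linear-time computable.
   Context: Position-faithful one-tape Turing machine: a Turing machine with one semi-infinite tape (infinite in one direction only) whose left-most cell contains a special symbol $\boxplus$ which occurs only there and cannot be modified. On input $x\in\Sigma^*$ the initial tape content is $\boxplus x\boxdot^\infty$, where $\boxdot$ is a special blank symbol and $\Sigma\cap\{\boxplus,\boxdot\}=\varnothing$, and the head starts at $\boxplus$. The machine computes $f:\Sigma^*\to\Sigma^*$ if on every input $x\in\Sigma^*$ it eventually reaches an accepting state and halts with the tape having prefix $\boxplus f(x)\boxdot$ (no restriction on the tape content after this first $\boxdot$). A function $f:\Sigma^*\to\Sigma^*$ is position-faithful (p.f.) linear-time computable if it is computed by a deterministic position-faithful one-tape Turing machine in time linear in the input length. Let $G$ be a finitely generated group, $S=\{s_1,\dots,s_n\}\subset G$ a finite set of semigroup generators (every $g\in G$ is a product of elements of $S$), and $\mathcal{C}$ a nonempty class of languages. $G$ is $\mathcal{C}$-Cayley p.f. linear-time computable if there exist a language $L\subseteq\Sigma^*$ in the class $\mathcal{C}$ over a finite alphabet $\Sigma$, a bijection $\psi:L\to G$ and p.f. linear-time computable functions $f_i:\Sigma^*\to\Sigma^*$,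 $i=1,\dots,n$, with $f_i(L)\subseteq L$ and $\psi(f_i(w))=\psi(w)s_i$ for all $w\in L$. This notion does not depend on the choice of $S$. Standing assumption: $\mathcal{C}$ is closed under a change of symbols in the alphabet: if $\xi:\Sigma\to\Sigma'$ is a bijection between finite alphabets and $L\subseteq\Sigma^*$ is in $\mathcal{C}$, then the image of $L$ under the homomorphism induced by $\xi$ is in $\mathcal{C}$. *)

theory Defs
  imports "HOL-Algebra.Group" "HOL-Library.FuncSet"
begin

section \<open>Position-faithful one-tape Turing machines\<close>

text \<open>
  An input alphabet is a finite set \<open>\<Sigma>\<close> of symbols of type \<open>'s\<close>; wrapping its symbols in
  \<open>Letter\<close> makes it disjoint from the end marker and the blank. The constructor \<open>Aux\<close> provides
  an unlimited supply of further work symbols, of which every machine uses only finitely many.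
\<close>

datatype 's cell = LeftEnd | Blank | Letter 's | Aux nat

datatype move = MoveLeft | MoveRight | Stay

fun apply_move :: "move \<Rightarrow> nat \<Rightarrow> nat" where
  "apply_move MoveLeft p = p - 1"
| "apply_move MoveRight p = Suc p"
| "apply_move Stay p = p"

text \<open>
  The transition function is partial: the machine halts where it yields \<open>None\<close>.
\<close>

record 's machine =
  states :: "nat set"
  symbols :: "'s cell set"
  start :: nat
  accepting :: "nat set"
  trans :: "nat \<Rightarrow> 's cell \<Rightarrow> (nat \<times> 's cell \<times> move) option"

text \<open>
  The condition \<open>b = LeftEnd \<longleftrightarrow> a = LeftEnd\<close> says that the end marker is neither overwritten nor
  written anywhere else; as the head never moves left from it, the truncated subtraction in
  \<open>apply_move\<close> is never applied at position 0.
\<close>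

definition pf_machine :: "'s set \<Rightarrow> 's machine \<Rightarrow> bool" where
  "pf_machine \<Sigma> M \<longleftrightarrow>
     finite (states M) \<and> start M \<in> states M \<and> accepting M \<subseteq> states M \<and>
     finite (symbols M) \<and> {LeftEnd, Blank} \<union> Letter ` \<Sigma> \<subseteq> symbols M \<and>
     (\<forall>q \<in> states M. \<forall>a \<in> symbols M. \<forall>q' b d. trans M q a = Some (q', b, d) \<longrightarrow>
        q' \<in> states M \<and> b \<in> symbols M \<and>
        (b = LeftEnd \<longleftrightarrow> a = LeftEnd) \<and> (a = LeftEnd \<longrightarrow> d \<noteq> MoveLeft))"

text \<open>A configuration consists of the state, the head position and the tape content.\<close>

type_synonym 's config = "nat \<times> nat \<times> (nat \<Rightarrow> 's cell)"

fun step :: "'s machine \<Rightarrow> 's config \<Rightarrow> 's config \<Rightarrow> bool" where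
  "step M (q, p, T) c \<longleftrightarrow>
     (\<exists>q' b d. trans M q (T p) = Some (q', b, d) \<and> c = (q', apply_move d p, T(p := b)))"

definition initial_tape :: "'s list \<Rightarrow> nat \<Rightarrow> 's cell" where
  "initial_tape x i =
     (case i of 0 \<Rightarrow> LeftEnd | Suc j \<Rightarrow> if j < length x then Letter (x ! j) else Blank)"

definition output_prefix :: "'s list \<Rightarrow> (nat \<Rightarrow> 's cell) \<Rightarrow> bool" where
  "output_prefix y T \<longleftrightarrow>
     T 0 = LeftEnd \<and> (\<forall>j < length y. T (Suc j) = Letter (y ! j)) \<and> T (Suc (length y)) = Blank"

definition outputs_within :: "'s machine \<Rightarrow> 's list \<Rightarrow> 's list \<Rightarrow> nat \<Rightarrow> bool" where
  "outputs_within M x y n \<longleftrightarrow>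
     (\<exists>t \<le> n. \<exists>q p T. (step M ^^ t) (start M, 0, initial_tape x) (q, p, T) \<and>
        trans M q (T p) = None \<and> q \<in> accepting M \<and> output_prefix y T)"

definition pf_linear_time_computable :: "'s set \<Rightarrow> ('s list \<Rightarrow> 's list) \<Rightarrow> bool" where
  "pf_linear_time_computable \<Sigma> f \<longleftrightarrow>
     f \<in> lists \<Sigma> \<rightarrow> lists \<Sigma> \<and>
     (\<exists>M c d. pf_machine \<Sigma> M \<and>
        (\<forall>x \<in> lists \<Sigma>. outputs_within M x (f x) (c * length x + d)))"


section \<open>Classes of languages\<close>

text \<open>
  The type \<open>'s\<close> serves as the universe from which all alphabets are drawn. It has to be infinite
  for every finite alphabet to have a copy disjoint from any other one.
\<close>

definition closed_under_symbol_change :: "'s list set set \<Rightarrow> bool" where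
  "closed_under_symbol_change \<C> \<longleftrightarrow>
     (\<forall>\<Sigma> \<Sigma>' \<xi> L. finite \<Sigma> \<and> finite \<Sigma>' \<and> bij_betw \<xi> \<Sigma> \<Sigma>' \<and> L \<subseteq> lists \<Sigma> \<and> L \<in> \<C> \<longrightarrow>
        map \<xi> ` L \<in> \<C>)"

definition closed_under_disjoint_concat :: "'s list set set \<Rightarrow> bool" where
  "closed_under_disjoint_concat \<C> \<longleftrightarrow>
     (\<forall>\<Sigma>\<^sub>1 \<Sigma>\<^sub>2 L\<^sub>1 L\<^sub>2. finite \<Sigma>\<^sub>1 \<and> finite \<Sigma>\<^sub>2 \<and> \<Sigma>\<^sub>1 \<inter> \<Sigma>\<^sub>2 = {} \<and>
        L\<^sub>1 \<subseteq> lists \<Sigma>\<^sub>1 \<and> L\<^sub>2 \<subseteq> lists \<Sigma>\<^sub>2 \<and> L\<^sub>1 \<in> \<C> \<and> L\<^sub>2 \<in> \<C> \<longrightarrow>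
        {u @ v | u v. u \<in> L\<^sub>1 \<and> v \<in> L\<^sub>2} \<in> \<C>)"


section \<open>Cayley position-faithful linear-time computable groups\<close>

text \<open>The set of all nonempty products of elements of \<open>S\<close>.\<close>

inductive_set products :: "('a, 'm) monoid_scheme \<Rightarrow> 'a set \<Rightarrow> 'a set"
  for G :: "('a, 'm) monoid_scheme" and S :: "'a set" where
  single: "s \<in> S \<Longrightarrow> s \<in> products G S"
| mult: "g \<in> products G S \<Longrightarrow> s \<in> S \<Longrightarrow> g \<otimes>\<^bsub>G\<^esub> s \<in> products G S"

definition semigroup_generators :: "('a, 'm) monoid_scheme \<Rightarrow> 'a set \<Rightarrow> bool" where
  "semigroup_generators G S \<longleftrightarrow>
     finite S \<and> S \<subseteq> carrier G \<and> carrier G \<subseteq> products G S"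

text \<open>
  The functions \<open>f\<^sub>1, \<dots>, f\<^sub>n\<close> belonging to the generators are indexed by the generators themselves.
  The property does not depend on the generating set, which is therefore quantified existentially.
\<close>

definition cayley_pf_linear_time ::
    "'s list set set \<Rightarrow> ('a, 'm) monoid_scheme \<Rightarrow> bool" where
  "cayley_pf_linear_time \<C> G \<longleftrightarrow>
     group G \<and>
     (\<exists>S. semigroup_generators G S \<and>
       (\<exists>\<Sigma> L \<psi> f. finite \<Sigma> \<and> L \<subseteq> lists \<Sigma> \<and> L \<in> \<C> \<and> bij_betw \<psi> L (carrier G) \<and>
         (\<forall>s \<in> S. pf_linear_time_computable \<Sigma> (f s) \<and> f s ` L \<subseteq> L \<and>
            (\<forall>w \<in> L. \<psi> (f s w) = \<psi> w \<otimes>\<^bsub>G\<^esub> s))))"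

end

theory Submission
  imports Defs
begin

text \<open>
  After a renaming, the two groups are represented by languages over disjoint alphabets, and a pair
  of elements by the concatenation \<open>u @ v\<close> of the two representatives. The product is generated by
  the generators of either group, paired with the neutral element of the other one. What has to be
  shown is that \<open>u @ v \<mapsto> u @ g v\<close> and \<open>u @ v \<mapsto> f u @ v\<close> can be computed in linear time if \<open>g\<close> and
  \<open>f\<close> can.

  For the second factor this is easy: the machine for \<open>g\<close> is started at the last letter of \<open>u\<close>, and
  all letters of the first alphabet look like the end marker to it
  (\<open>pf_linear_time_computable_second_factor\<close>).

  For the first factor the machine for \<open>f\<close> runs on a separate track, on which \<open>v\<close> is invisible, and
  then \<open>v\<close> has to be shifted by the difference of the lengths of \<open>f u\<close> and \<open>u\<close>. On a single tape
  this takes linear time only if that difference is bounded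
  (\<open>pf_linear_time_computable_first_factor\<close>), and it is, for two reasons.

  \<^item> A function computed in linear time lengthens its argument by at most a constant
    (\<open>pf_linear_time_output_length\<close>). This is Hennie's argument on crossing sequences: in linear time
    most boundaries between cells are crossed only a few times, so two boundaries within a long input
    have the same crossing sequence. The segment between them can be cut out without changing the
    rest of the computation, which shortens input and output by the same amount.

  \<^item> The action of a generator \<open>s\<close> shortens representatives by at most a constant
    (\<open>length_le_of_products\<close>), because it is undone by multiplication with the inverse of \<open>s\<close>, a
    product of generators, each of which lengthens representatives by at most a constant.
\<close>

section \<open>Programs over arbitrary states and symbols\<close>

type_synonym ('q, 'b) program = "'q \<Rightarrow> 'b \<Rightarrow> ('q \<times> 'b \<times> move) option"

text \<open>
  The number bounds the running time from above, so that phases of a computation compose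
  without an exact count of their steps.
\<close>

inductive reaches ::
    "('q, 'b) program \<Rightarrow> nat \<Rightarrow> 'q \<times> nat \<times> (nat \<Rightarrow> 'b) \<Rightarrow> 'q \<times> nat \<times> (nat \<Rightarrow> 'b) \<Rightarrow> bool"
  for \<delta> where
  refl: "reaches \<delta> n c c"
| step: "\<delta> q (T p) = Some (q', b, d) \<Longrightarrow> reaches \<delta> n (q', apply_move d p, T(p := b)) c
    \<Longrightarrow> reaches \<delta> (Suc n) (q, p, T) c"

lemmas reaches_induct = reaches.induct[split_format(complete), consumes 1, case_names refl step]

lemma reaches_mono: "reaches \<delta> m c c' \<Longrightarrow> m \<le> n \<Longrightarrow> reaches \<delta> n c c'"
proof (induction arbitrary: n rule: reaches.induct)
  case (step q T p q' b d m c)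
  then obtain n' where "n = Suc n'" "m \<le> n'" by (cases n) auto
  then show ?case using step reaches.step by metis
qed (rule reaches.refl)

lemma reaches_trans: "reaches \<delta> m c c' \<Longrightarrow> reaches \<delta> n c' c'' \<Longrightarrow> reaches \<delta> (m + n) c c''"
proof (induction rule: reaches.induct)
  case (refl m c)
  then show ?case by (rule reaches_mono) simp
next
  case (step q T p q' b d m c)
  then show ?case by (simp add: reaches.step)
qed

lemma reaches_append:
  "reaches \<delta> m c c' \<Longrightarrow> reaches \<delta> n c' c'' \<Longrightarrow> m + n \<le> k \<Longrightarrow> reaches \<delta> k c c''"
  by (rule reaches_mono[OF reaches_trans])

lemma reaches_single:
  "\<delta> q (T p) = Some (q', b, d) \<Longrightarrow> c = (q', apply_move d p, T(p := b)) \<Longrightarrow> reaches \<delta> 1 (q, p, T) c"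
  by (auto intro: reaches.intros)

lemma reaches_position: "reaches \<delta> n (q, p, T) (q', p', T') \<Longrightarrow> p' \<le> p + n"
proof (induction rule: reaches_induct)
  case (step q T p q' b d n q2 p2 T2)
  then show ?case by (cases d) auto
qed simp

lemma reaches_sweep_right:
  assumes "\<And>i. i < m \<Longrightarrow> \<delta> (s i) (T (p + i)) = Some (s (Suc i), T (p + i), MoveRight)"
  shows "reaches \<delta> m (s 0, p, T) (s m, p + m, T)"
  using assms
proof (induction m)
  case (Suc m)
  have "reaches \<delta> 1 (s m, p + m, T) (s (Suc m), p + Suc m, T)"
    using Suc.prems[of m] by (intro reaches_single[where b = "T (p + m)" and d = MoveRight]) auto
  with Suc show ?case using reaches_trans[of \<delta> m _ _ 1] by fastforce
qed (simp add: reaches.refl)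

lemma reaches_sweep_left:
  assumes "\<And>i. i < m \<Longrightarrow> \<delta> (s (Suc i)) (T (p + Suc i)) = Some (s i, T (p + Suc i), MoveLeft)"
  shows "reaches \<delta> m (s m, p + m, T) (s 0, p, T)"
  using assms
proof (induction m)
  case (Suc m)
  have "reaches \<delta> 1 (s (Suc m), p + Suc m, T) (s m, p + m, T)"
    using Suc.prems[of m] by (intro reaches_single[where b = "T (p + Suc m)" and d = MoveLeft]) auto
  with Suc show ?case using reaches_trans[of \<delta> 1 _ _ m] by fastforce
qed (simp add: reaches.refl)

lemma reaches_iff_relpowp: "reaches (trans M) n c c' \<longleftrightarrow> (\<exists>t \<le> n. (step M ^^ t) c c')"
proof
  assume "reaches (trans M) n c c'"
  then show "\<exists>t \<le> n. (step M ^^ t) c c'"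
  proof (induction rule: reaches.induct)
    case (refl n c)
    show ?case by (rule exI[of _ 0]) simp
  next
    case (step q T p q' b d n c)
    then obtain t where "t \<le> n" "(step M ^^ t) (q', apply_move d p, T(p := b)) c" by blast
    then have "(step M ^^ Suc t) (q, p, T) c"
      using step.hyps(1) by (intro relpowp_Suc_I2) auto
    then show ?case using \<open>t \<le> n\<close> by (meson Suc_le_mono)
  qed
next
  assume "\<exists>t \<le> n. (step M ^^ t) c c'"
  then obtain t where "t \<le> n" and run: "(step M ^^ t) c c'" by blast
  from run have "reaches (trans M) t c c'"
  proof (induction t arbitrary: c)
    case 0
    then show ?case by (simp add: reaches.refl)
  next
    case (Suc t)
    obtain q p T where c: "c = (q, p, T)" by (cases c)
    from Suc.prems obtain c1 where "step M c c1" "(step M ^^ t) c1 c'"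
      by (meson relpowp_Suc_E2)
    then show ?case using Suc.IH c by (auto intro: reaches.step)
  qed
  then show "reaches (trans M) n c c'" using \<open>t \<le> n\<close> by (rule reaches_mono)
qed

lemma outputs_withinE:
  assumes "outputs_within M x y n"
  obtains q p T where "reaches (trans M) n (start M, 0, initial_tape x) (q, p, T)"
    and "trans M q (T p) = None" and "output_prefix y T"
proof -
  obtain t q p T where "t \<le> n" "(step M ^^ t) (start M, 0, initial_tape x) (q, p, T)"
    and *: "trans M q (T p) = None" "output_prefix y T"
    using assms unfolding outputs_within_def by (elim exE conjE)
  then have "reaches (trans M) n (start M, 0, initial_tape x) (q, p, T)"
    by (subst reaches_iff_relpowp) (intro exI conjI)
  from this * show thesis by (rule that)
qed

lemma output_prefix_iff_initial_tape:
  "output_prefix y T \<longleftrightarrow> (\<forall>i \<le> Suc (length y). T i = initial_tape y i)"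
proof
  assume l: "output_prefix y T"
  show "\<forall>i \<le> Suc (length y). T i = initial_tape y i"
  proof (intro allI impI)
    fix i assume "i \<le> Suc (length y)"
    then show "T i = initial_tape y i"
      using l by (cases i) (auto simp: output_prefix_def initial_tape_def less_Suc_eq_le le_less)
  qed
next
  assume r: "\<forall>i \<le> Suc (length y). T i = initial_tape y i"
  have "T (Suc j) = Letter (y ! j)" if "j < length y" for j
    using r[rule_format, of "Suc j"] that by (simp add: initial_tape_def)
  then show "output_prefix y T"
    using r[rule_format, of 0] r[rule_format, of "Suc (length y)"]
    by (simp add: output_prefix_def initial_tape_def)
qed

definition computes_within ::
    "('q, 'b) program \<Rightarrow> 'q \<Rightarrow> ('s cell \<Rightarrow> 'b) \<Rightarrow> 's list \<Rightarrow> 's list \<Rightarrow> nat \<Rightarrow> bool" where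
  "computes_within \<delta> q\<^sub>0 enc x y n \<longleftrightarrow>
     (\<exists>q p T. reaches \<delta> n (q\<^sub>0, 0, \<lambda>i. enc (initial_tape x i)) (q, p, T) \<and> \<delta> q (T p) = None \<and>
        (\<forall>i \<le> Suc (length y). T i = enc (initial_tape y i)))"

lemma outputs_within_imp_computes_within:
  "outputs_within M x y n \<Longrightarrow> computes_within (trans M) (start M) (\<lambda>c. c) x y n"
  unfolding outputs_within_def computes_within_def reaches_iff_relpowp output_prefix_iff_initial_tape
  by blast

text \<open>The cells that can occur on an initial tape or in an output.\<close>

abbreviation io_cells :: "'s set \<Rightarrow> 's cell set" where
  "io_cells \<Sigma> \<equiv> {LeftEnd, Blank} \<union> Letter ` \<Sigma>"

lemma pf_machineD:
  assumes "pf_machine \<Sigma> M"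
  shows "finite (states M)" and "start M \<in> states M" and "finite (symbols M)"
    and "io_cells \<Sigma> \<subseteq> symbols M"
    and "\<lbrakk>q \<in> states M; a \<in> symbols M; trans M q a = Some (q', b, d)\<rbrakk> \<Longrightarrow>
        q' \<in> states M \<and> b \<in> symbols M \<and> (b = LeftEnd \<longleftrightarrow> a = LeftEnd) \<and>
        (a = LeftEnd \<longrightarrow> d \<noteq> MoveLeft)"
  using assms unfolding pf_machine_def by (elim conjE, (assumption | blast))+

lemma initial_tape_in_io_cells: "x \<in> lists \<Sigma> \<Longrightarrow> initial_tape x i \<in> io_cells \<Sigma>"
  by (cases i) (auto simp: initial_tape_def in_lists_conv_set)

lemma initial_tape_eq_LeftEnd [simp]: "initial_tape x i = LeftEnd \<longleftrightarrow> i = 0"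
  by (auto simp: initial_tape_def split: nat.split)

text \<open>
  A position-faithful machine whose states and symbols are drawn from arbitrary types; \<open>enc\<close> tells
  which of its symbols stand for the input and output cells.
\<close>

definition pf_program ::
    "'s set \<Rightarrow> ('s cell \<Rightarrow> 'b) \<Rightarrow> 'q set \<Rightarrow> 'b set \<Rightarrow> 'q \<Rightarrow> ('q, 'b) program \<Rightarrow> bool" where
  "pf_program \<Sigma> enc Q \<Gamma> q\<^sub>0 \<delta> \<longleftrightarrow>
     finite Q \<and> q\<^sub>0 \<in> Q \<and> finite \<Gamma> \<and> inj_on enc (io_cells \<Sigma>) \<and> enc ` io_cells \<Sigma> \<subseteq> \<Gamma> \<and>
     (\<forall>q \<in> Q. \<forall>a \<in> \<Gamma>. \<forall>q' b d. \<delta> q a = Some (q', b, d) \<longrightarrow>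
        q' \<in> Q \<and> b \<in> \<Gamma> \<and> (b = enc LeftEnd \<longleftrightarrow> a = enc LeftEnd) \<and>
        (a = enc LeftEnd \<longrightarrow> d \<noteq> MoveLeft))"

text \<open>
  The symbols that encode input and output cells must be those cells; the remaining ones, finite
  in number, fit into the supply of auxiliary cells. All states may be accepting, because a
  program is only ever asked about inputs on which it halts with the right result.
\<close>

lemma pf_program_realizable:
  fixes enc :: "'s cell \<Rightarrow> 'b" and Q :: "'q set"
  assumes "pf_program \<Sigma> enc Q \<Gamma> q\<^sub>0 \<delta>"
  obtains M where "pf_machine \<Sigma> M"
    and "\<And>x y n. x \<in> lists \<Sigma> \<Longrightarrow> y \<in> lists \<Sigma> \<Longrightarrow> computes_within \<delta> q\<^sub>0 enc x y n
      \<Longrightarrow> outputs_within M x y n"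
proof -
  let ?B = "io_cells \<Sigma>"
  have finQ: "finite Q" and q0: "q\<^sub>0 \<in> Q" and fin\<Gamma>: "finite \<Gamma>" and inj_enc: "inj_on enc ?B"
    and enc: "\<And>c. c \<in> ?B \<Longrightarrow> enc c \<in> \<Gamma>"
    and legal: "\<And>q a q' b d. \<lbrakk>q \<in> Q; a \<in> \<Gamma>; \<delta> q a = Some (q', b, d)\<rbrakk> \<Longrightarrow>
        q' \<in> Q \<and> b \<in> \<Gamma> \<and> (b = enc LeftEnd \<longleftrightarrow> a = enc LeftEnd) \<and>
        (a = enc LeftEnd \<longrightarrow> d \<noteq> MoveLeft)"
    using assms unfolding pf_program_def by blast+
  obtain g :: "'q \<Rightarrow> nat" where g: "inj_on g Q"
    using finite_imp_inj_to_nat_seg[OF finQ] by blast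
  obtain h :: "'b \<Rightarrow> nat" where h: "inj_on h \<Gamma>"
    using finite_imp_inj_to_nat_seg[OF fin\<Gamma>] by blast
  define e where "e a = (if a \<in> enc ` ?B then inv_into ?B enc a else Aux (h a))" for a
  have e_enc: "e (enc c) = c" if "c \<in> ?B" for c
    using that inj_enc by (auto simp: e_def)
  have "e a \<noteq> Aux k" if "a \<in> enc ` ?B" for a k
    using that e_enc by auto
  then have inj_e: "inj_on e \<Gamma>"
  proof (intro inj_onI)
    fix a b assume *: "\<And>a k. a \<in> enc ` ?B \<Longrightarrow> e a \<noteq> Aux k" and ab: "a \<in> \<Gamma>" "b \<in> \<Gamma>" "e a = e b"
    show "a = b"
    proof (cases "a \<in> enc ` ?B"; cases "b \<in> enc ` ?B")
      assume "a \<in> enc ` ?B" "b \<in> enc ` ?B"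
      then show ?thesis using ab(3) e_enc by auto
    next
      assume "a \<in> enc ` ?B" "b \<notin> enc ` ?B"
      then show ?thesis using ab(3) *[of a "h b"] by (simp add: e_def)
    next
      assume "a \<notin> enc ` ?B" "b \<in> enc ` ?B"
      then show ?thesis using ab(3) *[of b "h a"] by (simp add: e_def)
    next
      assume "a \<notin> enc ` ?B" "b \<notin> enc ` ?B"
      then show ?thesis using ab h by (auto simp: e_def inj_on_def)
    qed
  qed
  define tr where "tr n c =
      (if n \<in> g ` Q \<and> c \<in> e ` \<Gamma> then
         map_option (\<lambda>(q', b, d). (g q', e b, d)) (\<delta> (inv_into Q g n) (inv_into \<Gamma> e c))
       else None)" for n c
  have tr: "tr (g q) (e a) = map_option (\<lambda>(q', b, d). (g q', e b, d)) (\<delta> q a)"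
    if "q \<in> Q" "a \<in> \<Gamma>" for q a
    using that g inj_e by (simp add: tr_def)
  define M where "M = \<lparr>states = g ` Q, symbols = e ` \<Gamma>, start = g q\<^sub>0, accepting = g ` Q, trans = tr\<rparr>"
  have e_LeftEnd: "e a = LeftEnd \<longleftrightarrow> a = enc LeftEnd" if "a \<in> \<Gamma>" for a
    using inj_onD[OF inj_e, of a "enc LeftEnd"] that e_enc[of LeftEnd] enc[of LeftEnd] by auto
  have sim: "reaches (trans M) n (g q, p, e \<circ> T) (g q', p', e \<circ> T') \<and> q' \<in> Q \<and> range T' \<subseteq> \<Gamma>"
    if "reaches \<delta> n (q, p, T) (q', p', T')" "q \<in> Q" "range T \<subseteq> \<Gamma>" for n q p T q' p' T'
    using that
  proof (induction rule: reaches_induct)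
    case (refl n q p T)
    then show ?case by (simp add: reaches.refl)
  next
    case (step q T p q' b d n q2 p2 T2)
    have Tp: "T p \<in> \<Gamma>" using step.prems by auto
    have *: "q' \<in> Q" "b \<in> \<Gamma>" using legal[OF \<open>q \<in> Q\<close> Tp step.hyps(1)] by auto
    then have "range (T(p := b)) \<subseteq> \<Gamma>" using step.prems by auto
    with * step.IH have IH:
      "reaches (trans M) n (g q', apply_move d p, (e \<circ> T)(p := e b)) (g q2, p2, e \<circ> T2)"
      "q2 \<in> Q" "range T2 \<subseteq> \<Gamma>" by (simp_all only: fun_upd_comp)
    have "trans M (g q) ((e \<circ> T) p) = Some (g q', e b, d)"
      using tr[OF \<open>q \<in> Q\<close> Tp] step.hyps(1) by (simp add: M_def)
    with IH show ?case by (blast intro: reaches.step)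
  qed
  have "pf_machine \<Sigma> M"
    unfolding pf_machine_def
  proof (intro conjI ballI allI impI)
    have "c \<in> e ` \<Gamma>" if "c \<in> ?B" for c
      using that e_enc[of c] enc[of c] by (metis image_eqI)
    then show "?B \<subseteq> symbols M" by (auto simp: M_def)
  next
    fix n c n' b' d
    assume n: "n \<in> states M" and c: "c \<in> symbols M" and t: "trans M n c = Some (n', b', d)"
    obtain q a where q: "q \<in> Q" "n = g q" and a: "a \<in> \<Gamma>" "c = e a"
      using n c by (auto simp: M_def)
    then obtain q' b where \<delta>: "\<delta> q a = Some (q', b, d)" and n': "n' = g q'" "b' = e b"
      using t tr[of q a] by (auto simp: M_def)
    note l = legal[OF \<open>q \<in> Q\<close> \<open>a \<in> \<Gamma>\<close> \<delta>]
    show "n' \<in> states M" "b' \<in> symbols M" using l n' by (auto simp: M_def)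
    show "b' = LeftEnd \<longleftrightarrow> c = LeftEnd" using l n' a e_LeftEnd by simp
    assume "c = LeftEnd"
    then show "d \<noteq> MoveLeft" using l a e_LeftEnd by simp
  qed (use finQ fin\<Gamma> q0 in \<open>auto simp: M_def\<close>)
  moreover have "outputs_within M x y n"
    if x: "x \<in> lists \<Sigma>" and y: "y \<in> lists \<Sigma>" and c: "computes_within \<delta> q\<^sub>0 enc x y n" for x y n
  proof -
    obtain q p T where run: "reaches \<delta> n (q\<^sub>0, 0, \<lambda>i. enc (initial_tape x i)) (q, p, T)"
      and halt: "\<delta> q (T p) = None" and T: "\<forall>i \<le> Suc (length y). T i = enc (initial_tape y i)"
      using c unfolding computes_within_def by blast
    have "range (\<lambda>i. enc (initial_tape x i)) \<subseteq> \<Gamma>"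
      using enc initial_tape_in_io_cells[OF x] by blast
    with sim[OF run q0] have run':
      "reaches (trans M) n (g q\<^sub>0, 0, e \<circ> (\<lambda>i. enc (initial_tape x i))) (g q, p, e \<circ> T)"
      and q: "q \<in> Q" and T\<Gamma>: "range T \<subseteq> \<Gamma>" by auto
    have "e \<circ> (\<lambda>i. enc (initial_tape x i)) = initial_tape x"
      using e_enc[OF initial_tape_in_io_cells[OF x]] by (simp add: fun_eq_iff)
    moreover have "\<forall>i \<le> Suc (length y). (e \<circ> T) i = initial_tape y i"
      using T e_enc[OF initial_tape_in_io_cells[OF y]] by simp
    moreover have "trans M (g q) ((e \<circ> T) p) = None"
      using tr[OF q, of "T p"] T\<Gamma> halt by (auto simp: M_def)
    moreover have "g q \<in> accepting M" "start M = g q\<^sub>0" using q by (auto simp: M_def)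
    ultimately show ?thesis
      using run' unfolding outputs_within_def reaches_iff_relpowp output_prefix_iff_initial_tape
      by metis
  qed
  ultimately show thesis by (rule that)
qed

lemma initial_tape_map: "initial_tape (map h x) i = map_cell h (initial_tape x i)"
  by (auto simp: initial_tape_def split: nat.split)

lemma computes_within_map:
  "computes_within \<delta> q\<^sub>0 (\<lambda>c. c) (map h x) (map h y) n = computes_within \<delta> q\<^sub>0 (map_cell h) x y n"
  by (simp add: computes_within_def initial_tape_map)

lemma map_inv_into_map:
  assumes "bij_betw \<xi> \<Sigma> \<Sigma>'" "w \<in> lists \<Sigma>"
  shows "map (inv_into \<Sigma> \<xi>) (map \<xi> w) = w"
  using assms by (auto simp: bij_betw_inv_into_left map_idI)

lemma map_in_lists: "w \<in> lists A \<Longrightarrow> h ` A \<subseteq> B \<Longrightarrow> map h w \<in> lists B"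
  by (auto simp: image_subset_iff)

text \<open>A machine need not change at all when its input letters are read under other names.\<close>

lemma pf_linear_time_computable_rename:
  fixes \<xi> :: "'s \<Rightarrow> 's"
  assumes f: "pf_linear_time_computable \<Sigma> f" and \<xi>: "bij_betw \<xi> \<Sigma> \<Sigma>'"
  shows "pf_linear_time_computable \<Sigma>' (\<lambda>w. map \<xi> (f (map (inv_into \<Sigma> \<xi>) w)))"
proof -
  let ?\<zeta> = "inv_into \<Sigma> \<xi>"
  let ?f' = "\<lambda>w. map \<xi> (f (map ?\<zeta> w))"
  obtain M c d where M: "pf_machine \<Sigma> M"
    and out: "\<And>x. x \<in> lists \<Sigma> \<Longrightarrow> outputs_within M x (f x) (c * length x + d)"
    and f_lists: "f \<in> lists \<Sigma> \<rightarrow> lists \<Sigma>"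
    using f unfolding pf_linear_time_computable_def by blast
  have \<zeta>: "bij_betw ?\<zeta> \<Sigma>' \<Sigma>" using \<xi> by (rule bij_betw_inv_into)
  have \<zeta>_lists: "map ?\<zeta> w \<in> lists \<Sigma>" if "w \<in> lists \<Sigma>'" for w
    using that \<zeta> by (intro map_in_lists) (auto simp: bij_betw_def)
  have \<xi>_lists: "map \<xi> w \<in> lists \<Sigma>'" if "w \<in> lists \<Sigma>" for w
    using that \<xi> by (intro map_in_lists) (auto simp: bij_betw_def)
  have "inj_on (map_cell ?\<zeta>) (io_cells \<Sigma>')"
    using \<zeta> by (auto simp: inj_on_def bij_betw_def)
  moreover have "map_cell ?\<zeta> ` io_cells \<Sigma>' \<subseteq> symbols M"
    using M \<zeta> by (auto simp: pf_machine_def bij_betw_def image_subset_iff)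
  ultimately have "pf_program \<Sigma>' (map_cell ?\<zeta>) (states M) (symbols M) (start M) (trans M)"
    using M unfolding pf_program_def pf_machine_def cell.map by blast
  then obtain M' where M': "pf_machine \<Sigma>' M'"
    and out': "\<And>x y n. x \<in> lists \<Sigma>' \<Longrightarrow> y \<in> lists \<Sigma>' \<Longrightarrow>
      computes_within (trans M) (start M) (map_cell ?\<zeta>) x y n \<Longrightarrow> outputs_within M' x y n"
    by (rule pf_program_realizable) blast
  have f'_lists: "?f' w \<in> lists \<Sigma>'" if "w \<in> lists \<Sigma>'" for w
    using that f_lists \<zeta>_lists \<xi>_lists by blast
  have "outputs_within M' w (?f' w) (c * length w + d)" if w: "w \<in> lists \<Sigma>'" for w
  proof -
    have "computes_within (trans M) (start M) (\<lambda>c. c) (map ?\<zeta> w) (f (map ?\<zeta> w)) (c * length w + d)"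
      using outputs_within_imp_computes_within[OF out[OF \<zeta>_lists[OF w]]] by simp
    moreover have eq: "map ?\<zeta> (?f' w) = f (map ?\<zeta> w)"
      using f_lists \<zeta>_lists[OF w] by (intro map_inv_into_map[OF \<xi>]) blast
    ultimately have "computes_within (trans M) (start M) (map_cell ?\<zeta>) w (?f' w) (c * length w + d)"
      by (simp only: computes_within_map[symmetric] eq)
    then show ?thesis using out' w f'_lists by blast
  qed
  then show ?thesis
    unfolding pf_linear_time_computable_def using M' f'_lists by blast
qed

section \<open>Crossing sequences bound the growth of the output\<close>

text \<open>
  Besides its final tape, a halting run comes with the states and positions after each of its steps,
  on which its crossing sequences depend.
\<close>

inductive halting_run ::
    "('q, 'b) program \<Rightarrow> 'q \<Rightarrow> nat \<Rightarrow> (nat \<Rightarrow> 'b) \<Rightarrow> ('q \<times> nat) list \<Rightarrow> (nat \<Rightarrow> 'b) \<Rightarrow> bool"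
  for \<delta> where
  halt: "\<delta> q (T p) = None \<Longrightarrow> halting_run \<delta> q p T [] T"
| step: "\<delta> q (T p) = Some (q', b, d) \<Longrightarrow> halting_run \<delta> q' (apply_move d p) (T(p := b)) tr T'
    \<Longrightarrow> halting_run \<delta> q p T ((q', apply_move d p) # tr) T'"

inductive_cases halting_run_NilE: "halting_run \<delta> q p T [] T'"
inductive_cases halting_run_ConsE: "halting_run \<delta> q p T (c # tr) T'"

lemma ex_halting_run_step:
  assumes "\<delta> q (T p) = Some (q', b, d)" and "T\<^sub>1 = T(p := b)"
    and "halting_run \<delta> q' (apply_move d p) T\<^sub>1 tr T'"
  shows "\<exists>tr. halting_run \<delta> q p T tr T'"
  using assms halting_run.step by metis

lemma reaches_imp_halting_run:
  "reaches \<delta> n (q, p, T) (q', p', T') \<Longrightarrow> \<delta> q' (T' p') = None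
    \<Longrightarrow> \<exists>tr. halting_run \<delta> q p T tr T' \<and> length tr \<le> n"
proof (induction rule: reaches_induct)
  case (refl n q p T)
  then have "halting_run \<delta> q p T [] T" by (rule halting_run.halt)
  then show ?case by (intro exI[of _ "[]"]) simp
next
  case (step q T p q' b d n q2 p2 T2)
  then obtain tr where "halting_run \<delta> q' (apply_move d p) (T(p := b)) tr T2" "length tr \<le> n" by blast
  then show ?case using step.hyps(1)
    by (intro exI[of _ "(q', apply_move d p) # tr"]) (simp add: halting_run.step)
qed

lemma halting_run_deterministic:
  "halting_run \<delta> q p T tr T' \<Longrightarrow> halting_run \<delta> q p T tr' T'' \<Longrightarrow> T' = T''"
proof (induction arbitrary: tr' rule: halting_run.induct)
  case (halt q T p)
  show ?case using halt.prems halt.hyps by cases auto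
next
  case (step q T p q' b d tr T')
  note \<delta> = step.hyps(1) and IH = step.IH
  show ?case using step.prems
  proof cases
    case (step r b' d' tr'')
    then have "r = q'" "b' = b" "d' = d" using \<delta> by simp_all
    then show ?thesis using IH step by blast
  qed (use \<delta> in simp)
qed

text \<open>
  The crossing sequence at the boundary between the cells \<open>i\<close> and \<open>i + 1\<close>: the states in which the
  head arrives whenever it passes this boundary.
\<close>

fun crossings :: "nat \<Rightarrow> nat \<Rightarrow> ('q \<times> nat) list \<Rightarrow> 'q list" where
  "crossings i p [] = []"
| "crossings i p ((q, p') # tr) =
     (if p \<le> i \<longleftrightarrow> p' \<le> i then crossings i p' tr else q # crossings i p' tr)"

lemma sum_length_crossings_le:
  assumes "halting_run \<delta> q p T tr T'" and "finite I"
  shows "(\<Sum>i\<in>I. length (crossings i p tr)) \<le> length tr"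
  using assms(1)
proof induction
  case (step q T p q' b d tr T')
  let ?p' = "apply_move d p"
  have "(\<Sum>i\<in>I. length (crossings i p ((q', ?p') # tr)))
      = (\<Sum>i\<in>I. (if p \<le> i \<longleftrightarrow> ?p' \<le> i then 0 else 1) + length (crossings i ?p' tr))"
    by (intro sum.cong) auto
  also have "\<dots> = card {i \<in> I. \<not> (p \<le> i \<longleftrightarrow> ?p' \<le> i)} + (\<Sum>i\<in>I. length (crossings i ?p' tr))"
    using assms(2) by (simp add: sum.distrib sum.If_cases Int_def)
  also have "card {i \<in> I. \<not> (p \<le> i \<longleftrightarrow> ?p' \<le> i)} \<le> card {min p ?p'}"
    by (intro card_mono) (cases d; auto)+
  finally show ?case using step.IH by simp
qed simp

lemma crossings_in_states:
  assumes M: "pf_machine \<Sigma> M"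
  shows "halting_run (trans M) q p T tr T' \<Longrightarrow> q \<in> states M \<Longrightarrow> range T \<subseteq> symbols M
    \<Longrightarrow> set (crossings i p tr) \<subseteq> states M"
proof (induction rule: halting_run.induct)
  case (step q T p q' b d tr T')
  have "T p \<in> symbols M" using step.prems by auto
  then have *: "q' \<in> states M" "b \<in> symbols M"
    using pf_machineD(5)[OF M \<open>q \<in> states M\<close> _ step.hyps(1)] by blast+
  then have "range (T(p := b)) \<subseteq> symbols M" using step.prems by auto
  with * step.IH show ?case by simp
qed simp

definition glue :: "nat \<Rightarrow> nat \<Rightarrow> (nat \<Rightarrow> 'b) \<Rightarrow> (nat \<Rightarrow> 'b) \<Rightarrow> nat \<Rightarrow> 'b" where
  "glue i j A B k = (if k \<le> i then A k else B (k - i + j))"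

lemma glue_update_left: "p \<le> i \<Longrightarrow> (glue i j A B)(p := b) = glue i j (A(p := b)) B"
  by (auto simp: glue_def fun_eq_iff)

lemma glue_update_right: "j < p \<Longrightarrow> (glue i j A B)(p - j + i := b) = glue i j A (B(p := b))"
  by (auto simp: glue_def fun_eq_iff)

lemma glue_update_left_irrelevant: "i < p \<Longrightarrow> glue i j (A(p := b)) B = glue i j A B"
  by (auto simp: glue_def fun_eq_iff)

lemma glue_update_right_irrelevant: "p \<le> j \<Longrightarrow> glue i j A (B(p := b)) = glue i j A B"
  by (auto simp: glue_def fun_eq_iff)

text \<open>
  The part of the tape on one side of a boundary learns of the other side only through the states in
  which the head arrives. Two runs with equal crossing sequences can therefore be cut at their
  boundaries and joined crosswise. The run that is not in charge of the joined head is first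
  brought to its next crossing, which does not affect the joined tape.
\<close>

lemma glue_halting_runs:
  assumes "halting_run \<delta> qA pA A trA A'" and "halting_run \<delta> qB pB B trB B'"
    and "crossings i pA trA = crossings j pB trB"
    and "pA \<le> i \<longleftrightarrow> pB \<le> j"
  shows "\<exists>tr. if pA \<le> i then halting_run \<delta> qA pA (glue i j A B) tr (glue i j A' B')
    else halting_run \<delta> qB (pB - j + i) (glue i j A B) tr (glue i j A' B')"
  using assms
proof (induction "length trA + length trB" arbitrary: qA pA A trA qB pB B trB rule: less_induct)
  case less
  note A = less.prems(1) and B = less.prems(2) and eq = less.prems(3) and side = less.prems(4)
  show ?case
  proof (cases "pA \<le> i")
    case left: True
    then have leftB: "pB \<le> j" using side by simp
    show ?thesis
    proof (cases "\<exists>q' p' trB'. trB = (q', p') # trB' \<and> p' \<le> j")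
      case True
      then obtain q' p' trB' where trB: "trB = (q', p') # trB'" and p': "p' \<le> j" by blast
      from B[unfolded trB] obtain b where B1: "halting_run \<delta> q' p' (B(pB := b)) trB' B'"
        by (auto elim: halting_run_ConsE)
      show ?thesis
        using less.hyps[OF _ A B1] trB p' left leftB eq
        by (simp add: glue_update_right_irrelevant)
    next
      case B_crosses: False
      show ?thesis
      proof (cases trA)
        case Nil
        then have "trB = []"
          using eq B_crosses leftB by (cases trB) (auto split: if_splits)
        moreover have "\<delta> qA (A pA) = None" "A' = A" using A Nil by (auto elim: halting_run_NilE)
        moreover from \<open>trB = []\<close> have "B' = B" using B by (auto elim: halting_run_NilE)
        ultimately show ?thesis
          using left halting_run.halt[of \<delta> qA "glue i j A B" pA] by (auto simp: glue_def)
      next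
        case (Cons c trA')
        from A[unfolded Cons] obtain q' b d where \<delta>: "\<delta> qA (A pA) = Some (q', b, d)"
          and c: "c = (q', apply_move d pA)"
          and A1: "halting_run \<delta> q' (apply_move d pA) (A(pA := b)) trA' A'"
          by (auto elim: halting_run_ConsE)
        have \<delta>': "\<delta> qA (glue i j A B pA) = Some (q', b, d)" using \<delta> left by (simp add: glue_def)
        show ?thesis
        proof (cases "apply_move d pA \<le> i")
          case True
          then obtain tr where
            "halting_run \<delta> q' (apply_move d pA) (glue i j (A(pA := b)) B) tr (glue i j A' B')"
            using less.hyps[OF _ A1 B] Cons c left leftB eq by auto
          then show ?thesis
            using ex_halting_run_step[of \<delta> qA "glue i j A B" pA, OF \<delta>'
              glue_update_left[OF left, of j A B b, symmetric]] left by simp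
        next
          case False
          then have d: "d = MoveRight" "pA = i" using left by (cases d; simp)+
          have "crossings j pB trB = q' # crossings i (Suc i) trA'"
            using eq Cons c d by simp
          then obtain p' trB' where trB: "trB = (q', p') # trB'" and "j < p'"
            and eq': "crossings j p' trB' = crossings i (Suc i) trA'"
            using B_crosses leftB by (cases trB) (auto split: if_splits)
          from B[unfolded trB] obtain b' d' where B1: "halting_run \<delta> q' p' (B(pB := b')) trB' B'"
            and p': "p' = apply_move d' pB"
            by (auto elim: halting_run_ConsE)
          have "p' = Suc j" using p' leftB \<open>j < p'\<close> by (cases d'; simp)
          then obtain tr where
            "halting_run \<delta> q' (Suc i) (glue i j (A(pA := b)) (B(pB := b'))) tr (glue i j A' B')"
            using less.hyps[OF _ A1 B1] Cons trB d eq' by auto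
          then have "halting_run \<delta> q' (apply_move d pA) ((glue i j A B)(pA := b)) tr (glue i j A' B')"
            using d leftB by (simp add: glue_update_left glue_update_right_irrelevant)
          then show ?thesis
            using ex_halting_run_step[of \<delta> qA "glue i j A B" pA, OF \<delta>' HOL.refl] left by simp
        qed
      qed
    qed
  next
    case right: False
    then have rightB: "j < pB" using side by simp
    show ?thesis
    proof (cases "\<exists>q' p' trA'. trA = (q', p') # trA' \<and> i < p'")
      case True
      then obtain q' p' trA' where trA: "trA = (q', p') # trA'" and p': "i < p'" by blast
      from A[unfolded trA] obtain b where A1: "halting_run \<delta> q' p' (A(pA := b)) trA' A'"
        by (auto elim: halting_run_ConsE)
      show ?thesis
        using less.hyps[OF _ A1 B] trA p' right rightB eq
        by (simp add: glue_update_left_irrelevant)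
    next
      case A_crosses: False
      show ?thesis
      proof (cases trB)
        case Nil
        then have "trA = []"
          using eq A_crosses right by (cases trA) (auto split: if_splits)
        moreover have "\<delta> qB (B pB) = None" "B' = B" using B Nil by (auto elim: halting_run_NilE)
        moreover from \<open>trA = []\<close> have "A' = A" using A by (auto elim: halting_run_NilE)
        moreover have "glue i j A B (pB - j + i) = B pB" using rightB by (auto simp: glue_def)
        ultimately show ?thesis
          using right halting_run.halt[of \<delta> qB "glue i j A B" "pB - j + i"] by auto
      next
        case (Cons c trB')
        from B[unfolded Cons] obtain q' b d where \<delta>: "\<delta> qB (B pB) = Some (q', b, d)"
          and c: "c = (q', apply_move d pB)"
          and B1: "halting_run \<delta> q' (apply_move d pB) (B(pB := b)) trB' B'"
          by (auto elim: halting_run_ConsE)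
        have \<delta>': "\<delta> qB (glue i j A B (pB - j + i)) = Some (q', b, d)"
          using \<delta> rightB by (auto simp: glue_def)
        show ?thesis
        proof (cases "apply_move d pB \<le> j")
          case False
          then have "apply_move d (pB - j + i) = apply_move d pB - j + i"
            using rightB by (cases d) auto
          moreover obtain tr where
            "halting_run \<delta> q' (apply_move d pB - j + i) (glue i j A (B(pB := b))) tr (glue i j A' B')"
            using less.hyps[OF _ A B1] Cons c right rightB eq False by auto
          ultimately show ?thesis
            using ex_halting_run_step[of \<delta> qB "glue i j A B" "pB - j + i", OF \<delta>'
              glue_update_right[OF rightB, of i A B b, symmetric]] right by simp
        next
          case True
          then have d: "d = MoveLeft" "pB = Suc j" using rightB by (cases d; simp)+
          have "crossings i pA trA = q' # crossings j j trB'"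
            using eq Cons c d by simp
          then obtain p' trA' where trA: "trA = (q', p') # trA'" and "p' \<le> i"
            and eq': "crossings i p' trA' = crossings j j trB'"
            using A_crosses right by (cases trA) (auto split: if_splits)
          from A[unfolded trA] obtain b' d' where A1: "halting_run \<delta> q' p' (A(pA := b')) trA' A'"
            and p': "p' = apply_move d' pA"
            by (auto elim: halting_run_ConsE)
          have "p' = i" using p' right \<open>p' \<le> i\<close> by (cases d'; simp)
          then obtain tr where
            "halting_run \<delta> q' i (glue i j (A(pA := b')) (B(pB := b))) tr (glue i j A' B')"
            using less.hyps[OF _ A1 B1] Cons trA d eq' by auto
          then have "halting_run \<delta> q' (apply_move d (pB - j + i))
              ((glue i j A B)(pB - j + i := b)) tr (glue i j A' B')"
            using d right glue_update_right[OF rightB, of i A B b]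
            by (simp add: glue_update_left_irrelevant)
          then show ?thesis
            using ex_halting_run_step[of \<delta> qB "glue i j A B" "pB - j + i", OF \<delta>' HOL.refl] right by simp
        qed
      qed
    qed
  qed
qed

lemma initial_tape_remove_segment:
  assumes "i \<le> j" "j \<le> length u"
  shows "initial_tape (take i u @ drop j u) = glue i j (initial_tape u) (initial_tape u)"
proof
  fix k
  show "initial_tape (take i u @ drop j u) k = glue i j (initial_tape u) (initial_tape u) k"
    using assms by (cases k) (auto simp: initial_tape_def glue_def nth_append min_def Suc_diff_le add.commute)
qed

lemma output_prefix_length_unique:
  assumes y: "output_prefix y T" and "\<And>k. 0 < k \<Longrightarrow> k \<le> m \<Longrightarrow> T k \<noteq> Blank" and "T (Suc m) = Blank"
  shows "length y = m"
proof (rule ccontr)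
  assume "length y \<noteq> m"
  then consider "length y < m" | "m < length y" by linarith
  then show False
    using assms by cases (auto simp: output_prefix_def)
qed

text \<open>
  As the output extends beyond the second of two boundaries with equal crossing sequences, the
  removal of the cells between them takes letters away from the output and leaves its end in place.
\<close>

lemma remove_segment_from_run:
  fixes M :: "'s machine"
  assumes out: "\<And>x. x \<in> lists \<Sigma> \<Longrightarrow> outputs_within M x (f x) (c * length x + d)"
    and u: "u \<in> lists \<Sigma>" and ij: "i < j" "j \<le> length u" and long: "length u \<le> length (f u)"
    and run: "halting_run (trans M) (start M) 0 (initial_tape u) tr T" and T: "output_prefix (f u) T"
    and eq: "crossings i 0 tr = crossings j 0 tr"
  shows "length (f (take i u @ drop j u)) + (j - i) = length (f u)"
proof -
  let ?u' = "take i u @ drop j u"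
  have u': "?u' \<in> lists \<Sigma>" using u by (auto dest: in_set_takeD in_set_dropD)
  obtain tr1 where run1: "halting_run (trans M) (start M) 0 (initial_tape ?u') tr1 (glue i j T T)"
    using glue_halting_runs[OF run run eq] ij by (auto simp: initial_tape_remove_segment)
  obtain q p T2 where reach: "reaches (trans M) (c * length ?u' + d) (start M, 0, initial_tape ?u') (q, p, T2)"
    and halt: "trans M q (T2 p) = None" and T2: "output_prefix (f ?u') T2"
    by (rule outputs_withinE[OF out[OF u']])
  obtain tr2 where run2: "halting_run (trans M) (start M) 0 (initial_tape ?u') tr2 T2"
    using reaches_imp_halting_run[OF reach halt] by (elim exE conjE)
  have "T2 = glue i j T T" by (rule halting_run_deterministic[OF run2 run1])
  then have prefix: "output_prefix (f ?u') (glue i j T T)" using T2 by simp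
  let ?m = "length (f u) - (j - i)"
  have letters: "T k \<noteq> Blank" if "0 < k" "k \<le> length (f u)" for k
    using T that by (cases k) (auto simp: output_prefix_def)
  have "length (f ?u') = ?m"
  proof (rule output_prefix_length_unique[OF prefix])
    fix k assume "0 < k" "k \<le> ?m"
    then show "glue i j T T k \<noteq> Blank" using letters ij long by (auto simp: glue_def)
  next
    have "Suc ?m - i + j = Suc (length (f u))" "i < Suc ?m" using ij long by auto
    then show "glue i j T T (Suc ?m) = Blank" using T by (simp add: glue_def output_prefix_def)
  qed
  then show ?thesis using ij long by linarith
qed

text \<open>
  A step crosses at most one boundary, so for positive \<open>n\<close> no more than \<open>c * n + d \<le> (c + d) * n\<close>
  steps cannot cross more than half of \<open>n\<close> boundaries more than \<open>2 * (c + d)\<close> times each.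
\<close>

lemma many_short_crossing_sequences:
  assumes run: "halting_run \<delta> q p T tr T'" and tr: "length tr \<le> c * n + d"
  shows "n \<le> 2 * card {i \<in> {1..n}. length (crossings i p tr) \<le> 2 * (c + d)}"
proof -
  let ?K = "2 * (c + d)"
  let ?short = "{i \<in> {1..n}. length (crossings i p tr) \<le> ?K}"
  let ?long = "{i \<in> {1..n}. ?K < length (crossings i p tr)}"
  have "card ?long * Suc ?K = (\<Sum>i\<in>?long. Suc ?K)" by simp
  also have "\<dots> \<le> (\<Sum>i\<in>?long. length (crossings i p tr))" by (intro sum_mono) auto
  also have "\<dots> \<le> length tr" using run by (rule sum_length_crossings_le) simp
  finally have *: "card ?long * Suc ?K \<le> c * n + d" using tr by linarith
  have "2 * card ?long \<le> n"
  proof (cases "n = 0")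
    case False
    define l where "l = card ?long"
    have "d \<le> d * n" using False by simp
    then have "l * Suc ?K \<le> n * (c + d)" using * by (simp only: l_def algebra_simps)
    then have le: "l + (2 * l) * (c + d) \<le> n * (c + d)" by (simp add: algebra_simps)
    have "2 * l \<le> n"
    proof (cases "c + d = 0")
      case True
      then show ?thesis using le by simp
    next
      case pos: False
      have "(2 * l) * (c + d) \<le> n * (c + d)" using le by linarith
      then show ?thesis using pos by (simp only: mult_le_cancel2)
    qed
    then show ?thesis by (simp only: l_def)
  qed simp
  moreover have "card ?short + card ?long = n"
  proof -
    have "?short \<union> ?long = {1..n}" "?short \<inter> ?long = {}" by auto
    then show ?thesis using card_Un_disjoint[of ?short ?long] by simp
  qed
  ultimately show ?thesis by linarith
qed

text \<open>
  Among the boundaries in a long input two have the same crossing sequence, because there are only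
  finitely many short ones. Removing what lies between them shortens input and output alike, so the
  excess of the output over the input is already attained on inputs of bounded length.
\<close>

theorem pf_linear_time_output_length:
  fixes f :: "'s list \<Rightarrow> 's list"
  assumes f: "pf_linear_time_computable \<Sigma> f"
  obtains C where "\<And>u. u \<in> lists \<Sigma> \<Longrightarrow> length (f u) \<le> length u + C"
proof -
  obtain M c d where M: "pf_machine \<Sigma> M"
    and out: "\<And>x. x \<in> lists \<Sigma> \<Longrightarrow> outputs_within M x (f x) (c * length x + d)"
    using f unfolding pf_linear_time_computable_def by blast
  let ?K = "2 * (c + d)"
  define short_seqs where "short_seqs = {cs. set cs \<subseteq> states M \<and> length cs \<le> ?K}"
  have fin: "finite short_seqs"
    unfolding short_seqs_def by (rule finite_lists_length_le[OF pf_machineD(1)[OF M]])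
  \<comment> \<open>At least half of the boundaries have a crossing sequence in \<open>short_seqs\<close>; beyond length \<open>N\<close> these
    boundaries outnumber the sequences.\<close>
  define N where "N = 2 * card short_seqs"
  have "finite (Letter ` \<Sigma>)" using pf_machineD(3,4)[OF M] by (meson finite_subset le_supE)
  then have "finite \<Sigma>" by (rule finite_imageD) (simp add: inj_on_def)
  then have fin_words: "finite {u. set u \<subseteq> \<Sigma> \<and> length u \<le> N}" by (rule finite_lists_length_le)
  define C where "C = Max ((\<lambda>u. length (f u)) ` {u. set u \<subseteq> \<Sigma> \<and> length u \<le> N})"
  have "length (f u) \<le> length u + C" if "u \<in> lists \<Sigma>" for u
    using that
  proof (induction "length u" arbitrary: u rule: less_induct)
    case less
    note u = less.prems
    show ?case
    proof (cases "length u \<le> N \<or> length (f u) \<le> length u")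
      case True
      have "length (f u) \<le> C" if "length u \<le> N"
        unfolding C_def using that u fin_words by (intro Max_ge) (auto simp: lists_eq_set)
      with True show ?thesis by auto
    next
      case False
      obtain q p T where reach: "reaches (trans M) (c * length u + d) (start M, 0, initial_tape u) (q, p, T)"
        and halt: "trans M q (T p) = None" and T: "output_prefix (f u) T"
        by (rule outputs_withinE[OF out[OF u]])
      obtain tr where run: "halting_run (trans M) (start M) 0 (initial_tape u) tr T"
        and tr: "length tr \<le> c * length u + d"
        using reaches_imp_halting_run[OF reach halt] by (elim exE conjE)
      let ?I = "{i \<in> {1..length u}. length (crossings i 0 tr) \<le> ?K}"
      have "range (initial_tape u) \<subseteq> symbols M" "start M \<in> states M"
        using pf_machineD(2,4)[OF M] initial_tape_in_io_cells[OF u] by blast+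
      then have "(\<lambda>i. crossings i 0 tr) ` ?I \<subseteq> short_seqs"
        using crossings_in_states[OF M run] by (auto simp: short_seqs_def)
      then have "card ((\<lambda>i. crossings i 0 tr) ` ?I) \<le> card short_seqs"
        using fin by (rule card_mono[rotated])
      also have "\<dots> < card ?I"
        using many_short_crossing_sequences[OF run tr] False by (simp add: N_def)
      finally have "\<not> inj_on (\<lambda>i. crossings i 0 tr) ?I" by (rule pigeonhole)
      then obtain i j where "i < j" "j \<le> length u" "crossings i 0 tr = crossings j 0 tr"
        unfolding inj_on_def by (auto, metis linorder_neqE_nat)
      then have cut: "length (f (take i u @ drop j u)) + (j - i) = length (f u)"
        using remove_segment_from_run[OF out u _ _ _ run T] False by auto
      have "length (f (take i u @ drop j u)) \<le> length (take i u @ drop j u) + C"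
        using \<open>i < j\<close> \<open>j \<le> length u\<close> u
        by (intro less.hyps) (auto dest: in_set_takeD in_set_dropD)
      then show ?thesis using cut \<open>i < j\<close> \<open>j \<le> length u\<close> by simp
    qed
  qed
  then show thesis by (rule that)
qed

section \<open>Recognising concatenations\<close>

lemma initial_tape_0 [simp]: "initial_tape x 0 = LeftEnd"
  by (simp add: initial_tape_def)

lemma initial_tape_append_right:
  "length u < i \<Longrightarrow> initial_tape (u @ v) i = initial_tape v (i - length u)"
  by (auto simp: initial_tape_def nth_append split: nat.split)
    (metis Suc_diff_le less_Suc_eq_le old.nat.inject)+

lemma initial_tape_letter: "\<lbrakk>0 < i; i \<le> length x\<rbrakk> \<Longrightarrow> initial_tape x i = Letter (x ! (i - 1))"
  by (auto simp: initial_tape_def split: nat.split)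

lemma initial_tape_blank: "length x < i \<Longrightarrow> initial_tape x i = Blank"
  by (auto simp: initial_tape_def split: nat.split)

lemma reaches_embed:
  assumes "\<And>q a. \<delta>' (h q) a = map_option (\<lambda>(q', b, d). (h q', b, d)) (\<delta> q a)"
  shows "reaches \<delta> n (q, p, T) (q', p', T') \<Longrightarrow> reaches \<delta>' n (h q, p, T) (h q', p', T')"
proof (induction rule: reaches_induct)
  case (step q T p q' b d n q2 p2 T2)
  show ?case
    by (rule reaches.step[OF _ step.IH]) (simp add: assms step.hyps(1))
qed (rule reaches.refl)

datatype 'q scan_state = Scan_First | Scan_Second | Rewind | Inner 'q

fun prescan :: "'s set \<Rightarrow> 's machine \<Rightarrow> (nat scan_state, 's cell) program" where
  "prescan A M Scan_First a = (case a of
      Letter x \<Rightarrow> Some (if x \<in> A then Scan_First else Scan_Second, a, MoveRight)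
    | LeftEnd \<Rightarrow> Some (Scan_First, a, MoveRight)
    | Blank \<Rightarrow> Some (Rewind, a, MoveLeft)
    | Aux _ \<Rightarrow> None)"
| "prescan A M Scan_Second a = (case a of
      Letter x \<Rightarrow> if x \<in> A then None else Some (Scan_Second, a, MoveRight)
    | Blank \<Rightarrow> Some (Rewind, a, MoveLeft)
    | _ \<Rightarrow> None)"
| "prescan A M Rewind a =
    (if a = LeftEnd then Some (Inner (start M), a, Stay) else Some (Rewind, a, MoveLeft))"
| "prescan A M (Inner q) a = map_option (\<lambda>(q', b, d). (Inner q', b, d)) (trans M q a)"

lemma pf_program_prescan:
  assumes M: "pf_machine \<Sigma> M"
  shows "pf_program \<Sigma> (\<lambda>c. c) ({Scan_First, Scan_Second, Rewind} \<union> Inner ` states M) (symbols M)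
    Scan_First (prescan A M)"
  unfolding pf_program_def
proof (intro conjI ballI allI impI)
  fix q a q' b d
  assume q: "q \<in> {Scan_First, Scan_Second, Rewind} \<union> Inner ` states M" and a: "a \<in> symbols M"
    and \<delta>: "prescan A M q a = Some (q', b, d)"
  have "(q' \<in> {Scan_First, Scan_Second, Rewind} \<union> Inner ` states M \<and> b \<in> symbols M) \<and>
    (b = LeftEnd \<longleftrightarrow> a = LeftEnd) \<and> (a = LeftEnd \<longrightarrow> d \<noteq> MoveLeft)"
  proof (cases q)
    case (Inner r)
    then obtain r' where "trans M r a = Some (r', b, d)" "q' = Inner r'" "r \<in> states M"
      using \<delta> q by auto
    then show ?thesis using pf_machineD(5)[OF M \<open>r \<in> states M\<close> a] by simp
  qed (use a \<delta> pf_machineD(2)[OF M] in \<open>auto split: cell.splits if_splits\<close>)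
  then show "q' \<in> {Scan_First, Scan_Second, Rewind} \<union> Inner ` states M" "b \<in> symbols M"
    "(b = LeftEnd) = (a = LeftEnd)" "a = LeftEnd \<Longrightarrow> d \<noteq> MoveLeft" by simp_all
qed (use pf_machineD(1-4)[OF M] in \<open>auto simp: inj_on_def\<close>)

lemma prescan_scan:
  assumes u: "u \<in> lists A" and v: "set v \<inter> A = {}"
  shows "reaches (prescan A M) (Suc (length u + length v)) (Scan_First, 0, initial_tape (u @ v @ w))
    (if v = [] then Scan_First else Scan_Second, Suc (length u + length v), initial_tape (u @ v @ w))"
proof -
  let ?T = "initial_tape (u @ v @ w)"
  have "prescan A M Scan_First (?T (0 + i)) = Some (Scan_First, ?T (0 + i), MoveRight)"
    if "i < Suc (length u)" for i
    using that u by (cases i) (auto simp: nth_append initial_tape_letter)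
  then have first: "reaches (prescan A M) (Suc (length u)) (Scan_First, 0, ?T)
      (Scan_First, Suc (length u), ?T)"
    using reaches_sweep_right[of "Suc (length u)" "prescan A M" "\<lambda>_. Scan_First" ?T 0] by simp
  show ?thesis
  proof (cases v)
    case Nil
    then show ?thesis using first by simp
  next
    case (Cons y v')
    have letter: "?T (Suc (length u) + i) = Letter (v ! i)" if "i < length v" for i
      using that by (simp add: nth_append initial_tape_letter)
    have enter: "reaches (prescan A M) 1 (Scan_First, Suc (length u), ?T)
        (Scan_Second, Suc (Suc (length u)), ?T)"
      using letter[of 0] v Cons by (intro reaches_single[where b = "?T (Suc (length u))" and d = MoveRight]) auto
    have "prescan A M Scan_Second (?T (Suc (Suc (length u)) + i))
        = Some (Scan_Second, ?T (Suc (Suc (length u)) + i), MoveRight)" if "i < length v'" for i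
    proof -
      have "v ! Suc i \<notin> A" using v that Cons by (auto simp: disjoint_iff)
      then show ?thesis using letter[of "Suc i"] that Cons by simp
    qed
    then have "reaches (prescan A M) (length v') (Scan_Second, Suc (Suc (length u)), ?T)
        (Scan_Second, Suc (Suc (length u)) + length v', ?T)"
      by (rule reaches_sweep_right[where s = "\<lambda>_. Scan_Second"])
    from reaches_trans[OF first reaches_trans[OF enter this]]
    show ?thesis using Cons by simp
  qed
qed

text \<open>
  A machine that works in linear time on the words \<open>u @ v\<close> can be made total: two sweeps suffice
  to recognise these words, and any other input is left as it is.
\<close>

lemma pf_linear_time_computable_from_factors:
  fixes F\<^sub>0 :: "'s list \<Rightarrow> 's list \<Rightarrow> 's list"
  assumes disj: "A \<inter> B = {}" and M: "pf_machine (A \<union> B) M"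
    and out: "\<And>u v. u \<in> lists A \<Longrightarrow> v \<in> lists B
      \<Longrightarrow> outputs_within M (u @ v) (F\<^sub>0 u v) (c * length (u @ v) + d)"
    and F\<^sub>0: "\<And>u v. u \<in> lists A \<Longrightarrow> v \<in> lists B \<Longrightarrow> F\<^sub>0 u v \<in> lists (A \<union> B)"
  obtains F where "pf_linear_time_computable (A \<union> B) F"
    and "\<And>u v. u \<in> lists A \<Longrightarrow> v \<in> lists B \<Longrightarrow> F (u @ v) = F\<^sub>0 u v"
proof -
  define F where "F x =
      (let u = takeWhile (\<lambda>a. a \<in> A) x; v = dropWhile (\<lambda>a. a \<in> A) x
       in if v \<in> lists B then F\<^sub>0 u v else x)" for x
  have F_append: "F (u @ v) = F\<^sub>0 u v" if "u \<in> lists A" "v \<in> lists B" for u v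
  proof -
    have "takeWhile (\<lambda>a. a \<in> A) v = []" "dropWhile (\<lambda>a. a \<in> A) v = v"
      using that(2) disj by (cases v; auto)+
    then show ?thesis using that by (simp add: F_def takeWhile_append dropWhile_append in_lists_conv_set)
  qed
  have split: "(\<exists>u \<in> lists A. \<exists>v \<in> lists B. x = u @ v) \<or>
      F x = x \<and> (\<exists>u \<in> lists A. \<exists>v a w. v \<noteq> [] \<and> set v \<inter> A = {} \<and> a \<in> A \<and> x = u @ v @ a # w)"
    if x: "x \<in> lists (A \<union> B)" for x
  proof -
    define u r where "u = takeWhile (\<lambda>a. a \<in> A) x" and "r = dropWhile (\<lambda>a. a \<in> A) x"
    define v w where "v = takeWhile (\<lambda>a. a \<notin> A) r" and "w = dropWhile (\<lambda>a. a \<notin> A) r"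
    have xu: "x = u @ r" and rv: "r = v @ w" by (simp_all add: u_def r_def v_def w_def)
    have u: "u \<in> lists A" by (auto simp: u_def dest: set_takeWhileD)
    have v: "set v \<inter> A = {}" by (auto simp: v_def dest: set_takeWhileD)
    show ?thesis
    proof (cases w)
      case Nil
      then have "r \<in> lists B" using x xu rv v by auto
      then show ?thesis using xu u by blast
    next
      case (Cons a w')
      then have a: "a \<in> A" using hd_dropWhile[of "\<lambda>a. a \<notin> A" r] by (simp add: w_def)
      have "v \<noteq> []"
      proof
        assume "v = []"
        then have "hd r \<in> A" "r \<noteq> []" using a rv Cons by auto
        then show False using hd_dropWhile[of "\<lambda>a. a \<in> A" x] by (simp add: r_def)
      qed
      moreover have "r \<notin> lists B" using a rv Cons disj by auto
      then have "F x = x" by (simp add: F_def r_def Let_def)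
      ultimately show ?thesis using u v a xu rv Cons by blast
    qed
  qed
  let ?\<delta> = "prescan A M"
  have wellformed: "computes_within ?\<delta> Scan_First (\<lambda>c. c) (u @ v) (F\<^sub>0 u v)
      ((c + 2) * length (u @ v) + (d + 3))" if u: "u \<in> lists A" and v: "v \<in> lists B" for u v
  proof -
    let ?x = "u @ v" and ?n = "length (u @ v)"
    let ?T = "initial_tape ?x"
    have "set v \<inter> A = {}" using v disj by auto
    from prescan_scan[OF u this, of M "[]"] obtain q where q: "q = Scan_First \<or> q = Scan_Second"
      and scan: "reaches ?\<delta> (Suc ?n) (Scan_First, 0, ?T) (q, Suc ?n, ?T)" by (simp split: if_splits) blast+
    have turn: "reaches ?\<delta> 1 (q, Suc ?n, ?T) (Rewind, ?n, ?T)"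
      using q by (intro reaches_single[where b = Blank and d = MoveLeft])
        (auto simp: initial_tape_blank fun_eq_iff)
    have "reaches ?\<delta> ?n (Rewind, 0 + ?n, ?T) (Rewind, 0, ?T)"
      by (rule reaches_sweep_left[where s = "\<lambda>_. Rewind"]) simp
    then have rewind: "reaches ?\<delta> ?n (Rewind, ?n, ?T) (Rewind, 0, ?T)" by simp
    have enter: "reaches ?\<delta> 1 (Rewind, 0, ?T) (Inner (start M), 0, ?T)"
      by (rule reaches_single[where b = LeftEnd and d = Stay]) (auto simp: fun_eq_iff)
    obtain q' p' T' where run: "reaches (trans M) (c * ?n + d) (start M, 0, ?T) (q', p', T')"
      and halt: "trans M q' (T' p') = None" and T': "output_prefix (F\<^sub>0 u v) T'"
      by (rule outputs_withinE[OF out[OF u v]])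
    have "reaches ?\<delta> (c * ?n + d) (Inner (start M), 0, ?T) (Inner q', p', T')"
      by (rule reaches_embed[OF _ run]) simp
    then have "reaches ?\<delta> (Suc ?n + (1 + (?n + (1 + (c * ?n + d))))) (Scan_First, 0, ?T) (Inner q', p', T')"
      by (intro reaches_trans[OF scan] reaches_trans[OF turn] reaches_trans[OF rewind]
          reaches_trans[OF enter])
    then have "reaches ?\<delta> ((c + 2) * ?n + (d + 3)) (Scan_First, 0, ?T) (Inner q', p', T')"
      by (rule reaches_mono) (simp add: algebra_simps)
    moreover have "?\<delta> (Inner q') (T' p') = None" using halt by simp
    ultimately show ?thesis
      using T' unfolding computes_within_def output_prefix_iff_initial_tape by (intro exI conjI)
  qed
  have malformed: "computes_within ?\<delta> Scan_First (\<lambda>c. c) x x ((c + 2) * length x + (d + 3))"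
    if "u \<in> lists A" "v \<noteq> []" "set v \<inter> A = {}" "a \<in> A" and x: "x = u @ v @ a # w" for u v a w x
  proof -
    have "reaches ?\<delta> (Suc (length u + length v)) (Scan_First, 0, initial_tape x)
        (Scan_Second, Suc (length u + length v), initial_tape x)"
      using prescan_scan[OF that(1,3), of M "a # w"] \<open>v \<noteq> []\<close> x by simp
    then have run: "reaches ?\<delta> ((c + 2) * length x + (d + 3)) (Scan_First, 0, initial_tape x)
        (Scan_Second, Suc (length u + length v), initial_tape x)"
      by (rule reaches_mono) (simp add: x)
    have "initial_tape x (Suc (length u + length v)) = Letter a"
      by (simp add: x initial_tape_letter nth_append)
    then have "?\<delta> Scan_Second (initial_tape x (Suc (length u + length v))) = None"
      using \<open>a \<in> A\<close> by simp
    with run show ?thesis unfolding computes_within_def by (intro exI conjI) auto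
  qed
  obtain M' where M': "pf_machine (A \<union> B) M'"
    and out': "\<And>x y n. x \<in> lists (A \<union> B) \<Longrightarrow> y \<in> lists (A \<union> B)
      \<Longrightarrow> computes_within ?\<delta> Scan_First (\<lambda>c. c) x y n \<Longrightarrow> outputs_within M' x y n"
    by (rule pf_program_realizable[OF pf_program_prescan[OF M, of A]]) blast
  have F_lists: "F x \<in> lists (A \<union> B)" if "x \<in> lists (A \<union> B)" for x
    using split[OF that]
  proof (elim disjE bexE conjE exE)
    fix u v assume "u \<in> lists A" "v \<in> lists B" "x = u @ v"
    then show ?thesis using F_append F\<^sub>0 by (simp only:)
  qed (use that in simp)
  have "outputs_within M' x (F x) ((c + 2) * length x + (d + 3))" if x: "x \<in> lists (A \<union> B)" for x
    using split[OF x]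
  proof (elim disjE bexE conjE exE)
    fix u v assume "u \<in> lists A" "v \<in> lists B" "x = u @ v"
    then show ?thesis using out'[OF x F_lists[OF x]] wellformed[of u v] F_append by simp
  next
    fix u v a w
    assume "F x = x" "u \<in> lists A" "v \<noteq> []" "set v \<inter> A = {}" "a \<in> A" "x = u @ v @ a # w"
    then show ?thesis using out'[OF x x] malformed[of u v a x w] by simp
  qed
  then have "pf_linear_time_computable (A \<union> B) F"
    unfolding pf_linear_time_computable_def using M' F_lists by blast
  then show thesis using F_append by (rule that)
qed

section \<open>Acting on the second factor\<close>

text \<open>
  A machine simulated on the first track, with cell \<open>k\<close> in the role of its left-most one, changes
  the tape \<open>T\<close> but neither the second track nor the cells before \<open>k\<close>, which are those of \<open>X\<close>.
\<close>

definition overlay :: "nat \<Rightarrow> (nat \<Rightarrow> 'b \<times> 'c) \<Rightarrow> (nat \<Rightarrow> 'b) \<Rightarrow> nat \<Rightarrow> 'b \<times> 'c" where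
  "overlay k X T i = (if i < k then X i else (T (i - k), snd (X i)))"

lemma overlay_update:
  "(overlay k X T)(k + p := (b, snd (overlay k X T (k + p)))) = overlay k X (T(p := b))"
  by (auto simp: overlay_def fun_eq_iff)

text \<open>
  Positions can be shifted by \<open>k\<close> although moving left is truncated at 0: the end marker stays at
  position 0, where the machine never moves left.
\<close>

lemma reaches_overlay:
  assumes M: "pf_machine \<Sigma> M"
    and \<delta>: "\<And>q q' m m' w d. trans M q m = Some (q', m', d) \<Longrightarrow> \<delta> (h q) (m, w) = Some (h q', (m', w), d)"
  shows "reaches (trans M) n (q, p, T) (q', p', T') \<Longrightarrow> q \<in> states M \<Longrightarrow> range T \<subseteq> symbols M
    \<Longrightarrow> (\<And>i. T i = LeftEnd \<longleftrightarrow> i = 0)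
    \<Longrightarrow> reaches \<delta> n (h q, k + p, overlay k X T) (h q', k + p', overlay k X T')
      \<and> (\<forall>i. T' i = LeftEnd \<longleftrightarrow> i = 0)"
proof (induction rule: reaches_induct)
  case (refl n q p T)
  then show ?case by (simp add: reaches.refl)
next
  case (step q T p q' b d n q2 p2 T2)
  have "T p \<in> symbols M" using step.prems by auto
  note legal = pf_machineD(5)[OF M \<open>q \<in> states M\<close> this step.hyps(1)]
  have IH: "reaches \<delta> n (h q', k + apply_move d p, overlay k X (T(p := b))) (h q2, k + p2, overlay k X T2)
      \<and> (\<forall>i. T2 i = LeftEnd \<longleftrightarrow> i = 0)"
    using step.prems legal by (intro step.IH) auto
  have "overlay k X T (k + p) = (T p, snd (overlay k X T (k + p)))"
    by (simp add: overlay_def)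
  then have \<delta>': "\<delta> (h q) (overlay k X T (k + p)) = Some (h q', (b, snd (overlay k X T (k + p))), d)"
    using \<delta>[OF step.hyps(1)] by metis
  have "d \<noteq> MoveLeft" if "p = 0" using that step.prems(3)[of p] legal by simp
  then have move: "apply_move d (k + p) = k + apply_move d p" by (cases d; cases p) auto
  have "reaches \<delta> n (h q', apply_move d (k + p),
      (overlay k X T)(k + p := (b, snd (overlay k X T (k + p))))) (h q2, k + p2, overlay k X T2)"
    unfolding overlay_update move using IH by (rule conjunct1)
  with IH show ?case using reaches.step[of \<delta> "h q" "overlay k X T" "k + p", OF \<delta>'] by blast
qed

text \<open>
  Letters of the first factor look like the end marker to the simulated machine. Hence it never
  moves left past the last of them, and overwriting the end marker with itself preserves the letter
  on the second track.
\<close>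

fun second_factor_symbol :: "'s set \<Rightarrow> 's cell \<Rightarrow> 's cell \<times> 's option" where
  "second_factor_symbol A (Letter x) = (if x \<in> A then (LeftEnd, Some x) else (Letter x, None))"
| "second_factor_symbol A c = (c, None)"

fun second_factor_program :: "'s machine \<Rightarrow> (nat option, 's cell \<times> 's option) program" where
  "second_factor_program M None (m, w) =
    (if m = LeftEnd then Some (None, (m, w), MoveRight) else Some (Some (start M), (m, w), MoveLeft))"
| "second_factor_program M (Some q) (m, w) =
    map_option (\<lambda>(q', m', d). (Some q', (m', w), d)) (trans M q m)"

lemma pf_program_second_factor:
  assumes M: "pf_machine B M" and "finite A"
  shows "pf_program (A \<union> B) (second_factor_symbol A) (insert None (Some ` states M))
    (symbols M \<times> insert None (Some ` A)) None (second_factor_program M)"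
  unfolding pf_program_def
proof (intro conjI ballI allI impI)
  fix q a q' b d
  assume q: "q \<in> insert None (Some ` states M)" and a: "a \<in> symbols M \<times> insert None (Some ` A)"
    and \<delta>: "second_factor_program M q a = Some (q', b, d)"
  obtain m w where mw: "a = (m, w)" by (cases a)
  have "(q' \<in> insert None (Some ` states M) \<and> b \<in> symbols M \<times> insert None (Some ` A)) \<and>
    (b = second_factor_symbol A LeftEnd \<longleftrightarrow> a = second_factor_symbol A LeftEnd) \<and>
    (a = second_factor_symbol A LeftEnd \<longrightarrow> d \<noteq> MoveLeft)"
  proof (cases q)
    case None
    then show ?thesis using a \<delta> mw pf_machineD(2)[OF M] by (auto split: if_splits)
  next
    case (Some r)
    then obtain r' m' where "trans M r m = Some (r', m', d)" "q' = Some r'" "b = (m', w)" "r \<in> states M"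
      using \<delta> q mw by auto
    moreover have "m \<in> symbols M" "w \<in> insert None (Some ` A)" using a mw by auto
    ultimately show ?thesis using pf_machineD(5)[OF M \<open>r \<in> states M\<close>] mw by auto
  qed
  then show "q' \<in> insert None (Some ` states M)" "b \<in> symbols M \<times> insert None (Some ` A)"
    "(b = second_factor_symbol A LeftEnd) = (a = second_factor_symbol A LeftEnd)"
    "a = second_factor_symbol A LeftEnd \<Longrightarrow> d \<noteq> MoveLeft" by simp_all
next
  show "inj_on (second_factor_symbol A) (io_cells (A \<union> B))"
    by (auto simp: inj_on_def split: if_splits)
  show "second_factor_symbol A ` io_cells (A \<union> B) \<subseteq> symbols M \<times> insert None (Some ` A)"
    using pf_machineD(4)[OF M] by (auto split: if_splits)
qed (use pf_machineD(1,3)[OF M] \<open>finite A\<close> in auto)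

lemma second_factor_symbol_initial_tape:
  assumes "u \<in> lists A" "v \<in> lists B" "A \<inter> B = {}"
  shows "second_factor_symbol A (initial_tape (u @ v) i) =
    (initial_tape v (i - length u), if 0 < i \<and> i \<le> length u then Some (u ! (i - 1)) else None)"
proof -
  consider "i = 0" | "0 < i" "i \<le> length u" | "length u < i" "i \<le> length u + length v"
    | "length u + length v < i" by linarith
  then show ?thesis
  proof cases
    case 2
    then have "u ! (i - 1) \<in> A" "i - 1 < length u" using assms(1) by auto
    then show ?thesis using 2 by (simp add: nth_append initial_tape_letter)
  next
    case 3
    then have "v ! (i - length u - 1) \<notin> A" using assms(2,3) by (auto simp: in_lists_conv_set)
    moreover have "initial_tape (u @ v) i = Letter (v ! (i - length u - 1))"
      using 3 by (simp only: initial_tape_append_right initial_tape_letter zero_less_diff le_diff_conv add.commute)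
    ultimately show ?thesis using 3 by (simp add: initial_tape_letter)
  qed (auto simp: initial_tape_blank)
qed

lemma pf_linear_time_computable_second_factor:
  fixes g :: "'s list \<Rightarrow> 's list"
  assumes g: "pf_linear_time_computable B g" and disj: "A \<inter> B = {}" and "finite A"
  obtains F where "pf_linear_time_computable (A \<union> B) F"
    and "\<And>u v. u \<in> lists A \<Longrightarrow> v \<in> lists B \<Longrightarrow> F (u @ v) = u @ g v"
proof -
  obtain M c d where M: "pf_machine B M"
    and out: "\<And>x. x \<in> lists B \<Longrightarrow> outputs_within M x (g x) (c * length x + d)"
    and g_lists: "g \<in> lists B \<rightarrow> lists B"
    using g unfolding pf_linear_time_computable_def by blast
  let ?enc = "second_factor_symbol A"
  let ?\<delta> = "second_factor_program M"
  have lists: "u @ g v \<in> lists (A \<union> B)" if "u \<in> lists A" "v \<in> lists B" for u v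
    using that g_lists by fastforce
  have computes: "computes_within ?\<delta> None ?enc (u @ v) (u @ g v) ((c + 1) * length (u @ v) + (d + 2))"
    if u: "u \<in> lists A" and v: "v \<in> lists B" for u v
  proof -
    let ?k = "length u"
    define X where "X i = ?enc (initial_tape (u @ v) i)" for i
    have X: "X i = (initial_tape v (i - ?k), if 0 < i \<and> i \<le> ?k then Some (u ! (i - 1)) else None)" for i
      unfolding X_def by (rule second_factor_symbol_initial_tape[OF u v disj])
    have "reaches ?\<delta> (Suc ?k) (None, 0, X) (None, 0 + Suc ?k, X)"
      by (rule reaches_sweep_right[where s = "\<lambda>_. None"]) (auto simp: X)
    then have walk: "reaches ?\<delta> (Suc ?k) (None, 0, X) (None, Suc ?k, X)" by simp
    have turn: "reaches ?\<delta> 1 (None, Suc ?k, X) (Some (start M), ?k, X)"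
      by (rule reaches_single[where b = "X (Suc ?k)" and d = MoveLeft]) (auto simp: X)
    obtain q' p' T' where run: "reaches (trans M) (c * length v + d) (start M, 0, initial_tape v) (q', p', T')"
      and halt: "trans M q' (T' p') = None" and T': "output_prefix (g v) T'"
      by (rule outputs_withinE[OF out[OF v]])
    have \<delta>: "?\<delta> (Some q) (m, w) = Some (Some q', (m', w), d)" if "trans M q m = Some (q', m', d)"
      for q q' m m' w d using that by simp
    have "range (initial_tape v) \<subseteq> symbols M"
      using initial_tape_in_io_cells[OF v] pf_machineD(4)[OF M] by blast
    from reaches_overlay[OF M, of ?\<delta> Some, OF \<delta> run pf_machineD(2)[OF M] this]
    have "reaches ?\<delta> (c * length v + d) (Some (start M), ?k + 0, overlay ?k X (initial_tape v))
        (Some q', ?k + p', overlay ?k X T')" by simp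
    moreover have "overlay ?k X (initial_tape v) = X" by (auto simp: overlay_def X fun_eq_iff)
    ultimately have main: "reaches ?\<delta> (c * length v + d) (Some (start M), ?k, X)
        (Some q', ?k + p', overlay ?k X T')" by simp
    have "reaches ?\<delta> (Suc ?k + (1 + (c * length v + d))) (None, 0, X) (Some q', ?k + p', overlay ?k X T')"
      by (intro reaches_trans[OF walk] reaches_trans[OF turn] main)
    then have "reaches ?\<delta> ((c + 1) * length (u @ v) + (d + 2)) (None, 0, X) (Some q', ?k + p', overlay ?k X T')"
      by (rule reaches_mono) (simp add: algebra_simps)
    moreover have "?\<delta> (Some q') (overlay ?k X T' (?k + p')) = None"
      using halt by (simp add: overlay_def)
    moreover have "\<forall>i \<le> Suc (length (u @ g v)). overlay ?k X T' i = ?enc (initial_tape (u @ g v) i)"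
    proof (intro allI impI)
      fix i assume "i \<le> Suc (length (u @ g v))"
      moreover have "g v \<in> lists B" using g_lists v by blast
      ultimately show "overlay ?k X T' i = ?enc (initial_tape (u @ g v) i)"
        using T' by (subst second_factor_symbol_initial_tape[OF u _ disj])
          (auto simp: overlay_def X output_prefix_iff_initial_tape)
    qed
    ultimately show ?thesis unfolding computes_within_def X_def[abs_def] by (intro exI conjI)
  qed
  obtain M' where M': "pf_machine (A \<union> B) M'"
    and out': "\<And>x y n. x \<in> lists (A \<union> B) \<Longrightarrow> y \<in> lists (A \<union> B)
      \<Longrightarrow> computes_within ?\<delta> None ?enc x y n \<Longrightarrow> outputs_within M' x y n"
    by (rule pf_program_realizable[OF pf_program_second_factor[OF M \<open>finite A\<close>]]) blast
  show thesis
  proof (rule pf_linear_time_computable_from_factors[OF disj M' _ lists])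
    fix u v assume uv: "u \<in> lists A" "v \<in> lists B"
    then have "u @ v \<in> lists (A \<union> B)" by auto
    then show "outputs_within M' (u @ v) (u @ g v) ((c + 1) * length (u @ v) + (d + 2))"
      using out' lists[OF uv] computes[OF uv] by blast
  qed (assumption+, rule that)
qed

section \<open>Acting on the first factor\<close>

text \<open>
  The machine for the first factor is run on the first track, while the second factor waits on the
  second track, where it looks blank to that machine.
\<close>

fun first_factor_symbol :: "'s set \<Rightarrow> 's cell \<Rightarrow> 's cell \<times> 's option" where
  "first_factor_symbol A (Letter x) = (if x \<in> A then (Letter x, None) else (Blank, Some x))"
| "first_factor_symbol A c = (c, None)"

lemma first_factor_symbol_initial_tape:
  assumes "u \<in> lists A" "v \<in> lists B" "A \<inter> B = {}"
  shows "first_factor_symbol A (initial_tape (u @ v) i) =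
    (initial_tape u i,
     if length u < i \<and> i \<le> length u + length v then Some (v ! (i - length u - 1)) else None)"
proof -
  consider "i = 0" | "0 < i" "i \<le> length u" | "length u < i" "i \<le> length u + length v"
    | "length u + length v < i" by linarith
  then show ?thesis
  proof cases
    case 2
    then have "u ! (i - 1) \<in> A" "i - 1 < length u" using assms(1) by auto
    then show ?thesis using 2 by (simp add: nth_append initial_tape_letter)
  next
    case 3
    then have "v ! (i - length u - 1) \<notin> A" using assms(2,3) by (auto simp: in_lists_conv_set)
    moreover have "initial_tape (u @ v) i = Letter (v ! (i - length u - 1))"
      using 3 by (simp only: initial_tape_append_right initial_tape_letter zero_less_diff le_diff_conv add.commute)
    ultimately show ?thesis using 3 by (simp add: initial_tape_blank)
  qed (auto simp: initial_tape_blank)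
qed

datatype 's transfer_state =
    Simulate nat
  | Return
  | Copy "'s list"
  | Emit "'s list"
  | Fetch nat
  | Carry 's nat

definition enqueue :: "'a list \<Rightarrow> 'a option \<Rightarrow> 'a list" where
  "enqueue l w = (case w of None \<Rightarrow> l | Some y \<Rightarrow> l @ [y])"

text \<open>
  After the simulation the second factor has to follow the new first factor immediately. If the
  first factor has grown, the overwritten letters of the second one are kept in a queue of at most
  \<open>C\<close> letters. If it has shrunk, the queue is empty, and each letter is fetched from the right and
  carried back. With an empty queue the machine need not know which case applies: it looks for a
  letter in the next \<open>C\<close> cells, and if there is none, the second factor is exhausted (or, with no
  letter placed, too far away) and the computation ends.
\<close>

fun first_factor_program ::
    "nat \<Rightarrow> 's machine \<Rightarrow> ('s transfer_state, 's cell \<times> 's option) program" where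
  "first_factor_program C M (Simulate q) (m, w) = (case trans M q m of
      Some (q', m', d) \<Rightarrow> Some (Simulate q', (m', w), d)
    | None \<Rightarrow> Some (Return, (m, w), Stay))"
| "first_factor_program C M Return (m, w) =
    (if m = LeftEnd then Some (Copy [], (m, w), MoveRight) else Some (Return, (m, w), MoveLeft))"
| "first_factor_program C M (Copy l) (m, w) = (case m of
      Letter x \<Rightarrow> if length (enqueue l w) \<le> C
        then Some (Copy (enqueue l w), (m, None), MoveRight) else None
    | Blank \<Rightarrow> Some (Emit l, (m, w), Stay)
    | _ \<Rightarrow> None)"
| "first_factor_program C M (Emit l) (m, w) = (if m = LeftEnd then None else (case enqueue l w of
      [] \<Rightarrow> Some (Fetch 1, (Blank, None), MoveRight)
    | y # l' \<Rightarrow> Some (Emit l', (Blank, Some y), MoveRight)))"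
| "first_factor_program C M (Fetch k) (m, w) = (if m = LeftEnd then None else (case w of
      Some y \<Rightarrow> Some (Carry y (k - 1), (Blank, None), MoveLeft)
    | None \<Rightarrow> if k < C then Some (Fetch (Suc k), (m, None), MoveRight) else None))"
| "first_factor_program C M (Carry y k) (m, w) = (if m = LeftEnd then None else (case k of
      0 \<Rightarrow> Some (Emit [], (Blank, Some y), MoveRight)
    | Suc k' \<Rightarrow> Some (Carry y k', (m, w), MoveLeft)))"

definition transfer_states :: "nat \<Rightarrow> 's machine \<Rightarrow> 's set \<Rightarrow> 's transfer_state set" where
  "transfer_states C M B =
     Simulate ` states M \<union> {Return} \<union> Copy ` {l. set l \<subseteq> B \<and> length l \<le> C} \<union>
     Emit ` {l. set l \<subseteq> B \<and> length l \<le> C} \<union> Fetch ` {..C} \<union> (\<lambda>(y, k). Carry y k) ` (B \<times> {..C})"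

lemma pf_program_first_factor:
  assumes M: "pf_machine A M" and "finite B" and "0 < C"
  shows "pf_program (A \<union> B) (first_factor_symbol A) (transfer_states C M B)
    (symbols M \<times> insert None (Some ` B)) (Simulate (start M)) (first_factor_program C M)"
  unfolding pf_program_def
proof (intro conjI ballI allI impI)
  let ?\<Gamma> = "symbols M \<times> insert None (Some ` B)"
  fix q a q' b d
  assume q: "q \<in> transfer_states C M B" and a: "a \<in> ?\<Gamma>"
    and \<delta>: "first_factor_program C M q a = Some (q', b, d)"
  obtain m w where mw: "a = (m, w)" by (cases a)
  have m: "m \<in> symbols M" and w: "w \<in> insert None (Some ` B)" using a mw by auto
  have blank: "Blank \<in> symbols M" using pf_machineD(4)[OF M] by auto
  have "q' \<in> transfer_states C M B \<and> b \<in> ?\<Gamma> \<and>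
    (b = (LeftEnd, None) \<longleftrightarrow> a = (LeftEnd, None)) \<and> (a = (LeftEnd, None) \<longrightarrow> d \<noteq> MoveLeft)"
  proof (cases q)
    case (Simulate r)
    then have r: "r \<in> states M" using q by (auto simp: transfer_states_def)
    show ?thesis
    proof (cases "trans M r m")
      case None
      then show ?thesis using \<delta> Simulate mw a by (auto simp: transfer_states_def)
    next
      case (Some t)
      then obtain r' m' where "trans M r m = Some (r', m', d)" "q' = Simulate r'" "b = (m', w)"
        using \<delta> Simulate mw by (cases t) auto
      then show ?thesis using pf_machineD(5)[OF M r m] mw w by (auto simp: transfer_states_def)
    qed
  next
    case Return
    then show ?thesis using \<delta> mw a by (auto simp: transfer_states_def split: if_splits)
  next
    case (Copy l)
    then show ?thesis using q \<delta> mw m w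
      by (auto simp: transfer_states_def enqueue_def split: cell.splits if_splits option.splits)
  next
    case (Emit l)
    then have l: "set l \<subseteq> B" "length l \<le> C" using q by (auto simp: transfer_states_def)
    have m': "m \<noteq> LeftEnd" using \<delta> mw Emit by auto
    show ?thesis
    proof (cases "enqueue l w")
      case Nil
      then show ?thesis using \<delta> mw Emit m' blank \<open>0 < C\<close> by (auto simp: transfer_states_def)
    next
      case (Cons y l')
      then have "set (y # l') \<subseteq> B" "length (y # l') \<le> Suc C"
        using l w unfolding Cons[symmetric] by (auto simp: enqueue_def)
      then show ?thesis using \<delta> mw Emit Cons m' blank by (auto simp: transfer_states_def)
    qed
  next
    case (Fetch k)
    then show ?thesis using q \<delta> mw m w blank
      by (auto simp: transfer_states_def image_iff split: if_splits option.splits)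
  next
    case (Carry y k)
    then show ?thesis using q \<delta> mw m w blank
      by (auto simp: transfer_states_def image_iff split: if_splits nat.splits)
  qed
  then show "q' \<in> transfer_states C M B" "b \<in> ?\<Gamma>"
    "(b = first_factor_symbol A LeftEnd) = (a = first_factor_symbol A LeftEnd)"
    "a = first_factor_symbol A LeftEnd \<Longrightarrow> d \<noteq> MoveLeft" by simp_all
next
  have "finite {l. set l \<subseteq> B \<and> length l \<le> C}" using \<open>finite B\<close> by (rule finite_lists_length_le)
  then show "finite (transfer_states C M B)"
    using pf_machineD(1)[OF M] \<open>finite B\<close> by (simp add: transfer_states_def)
  show "Simulate (start M) \<in> transfer_states C M B"
    using pf_machineD(2)[OF M] by (simp add: transfer_states_def)
  show "finite (symbols M \<times> insert None (Some ` B))"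
    using pf_machineD(3)[OF M] \<open>finite B\<close> by simp
  show "inj_on (first_factor_symbol A) (io_cells (A \<union> B))"
    by (auto simp: inj_on_def split: if_splits)
  show "first_factor_symbol A ` io_cells (A \<union> B) \<subseteq> symbols M \<times> insert None (Some ` B)"
    using pf_machineD(4)[OF M] by (auto simp: image_subset_iff split: if_splits)
qed

text \<open>
  The situation after \<open>j\<close> letters of \<open>v\<close> have been placed behind the new first factor \<open>r\<close>, where
  \<open>n\<close> is the length of the old one. Beyond the cells already written, the first track may still
  hold remains of the simulated computation.
\<close>

definition emitted ::
    "'s list \<Rightarrow> 's list \<Rightarrow> nat \<Rightarrow> nat \<Rightarrow> (nat \<Rightarrow> 's cell \<times> 's option) \<Rightarrow> bool" where
  "emitted r v n j X \<longleftrightarrow>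
     (\<forall>i \<le> length r + j.
        X i = (initial_tape r i, if length r < i then Some (v ! (i - length r - 1)) else None)) \<and>
     (\<forall>i > length r + j. fst (X i) \<noteq> LeftEnd \<and>
        snd (X i) = (if n + j < i \<and> i \<le> n + length v then Some (v ! (i - n - 1)) else None))"

text \<open>
  The letters of \<open>v\<close> that lay in the cells written so far and have not been placed yet. If the first
  factor has not grown, the truncated subtraction yields the empty queue.
\<close>

definition queue :: "'s list \<Rightarrow> 's list \<Rightarrow> nat \<Rightarrow> nat \<Rightarrow> 's list" where
  "queue r v n j = drop j (take (j + (length r - n)) v)"

lemma enqueue_queue:
  assumes "j < length v"
  shows "enqueue (queue r v n j)
      (if j + (length r - n) < length v then Some (v ! (j + (length r - n))) else None)
    = v ! j # queue r v n (Suc j)"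
proof -
  let ?e = "length r - n"
  have "enqueue (queue r v n j) (if j + ?e < length v then Some (v ! (j + ?e)) else None)
      = drop j (take (Suc (j + ?e)) v)"
    by (auto simp: enqueue_def queue_def take_Suc_conv_app_nth)
  also have "\<dots> = v ! j # queue r v n (Suc j)"
    using assms Cons_nth_drop_Suc[of j "take (Suc (j + ?e)) v"] by (simp add: queue_def)
  finally show ?thesis .
qed

lemma reaches_fetch:
  assumes "\<And>i. i < m \<Longrightarrow> fst (X (p + i)) \<noteq> LeftEnd \<and> snd (X (p + i)) = None" and "k + m \<le> C"
  shows "reaches (first_factor_program C M) m (Fetch k, p, X) (Fetch (k + m), p + m, X)"
proof -
  have "first_factor_program C M (Fetch (k + i)) (X (p + i))
      = Some (Fetch (k + Suc i), X (p + i), MoveRight)" if "i < m" for i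
    using assms(1)[OF that] assms(2) that by (cases "X (p + i)") auto
  then show ?thesis using reaches_sweep_right[of m "first_factor_program C M" "\<lambda>i. Fetch (k + i)" X p] by simp
qed

lemma reaches_carry:
  assumes "\<And>i. i < m \<Longrightarrow> fst (X (p + Suc i)) \<noteq> LeftEnd"
  shows "reaches (first_factor_program C M) m (Carry y m, p + m, X) (Carry y 0, p, X)"
proof (rule reaches_sweep_left)
  fix i assume "i < m"
  then show "first_factor_program C M (Carry y (Suc i)) (X (p + Suc i))
      = Some (Carry y i, X (p + Suc i), MoveLeft)"
    using assms[of i] by (cases "X (p + Suc i)") auto
qed

lemma emit_letter:
  assumes X: "emitted r v n j X" and j: "j < length v" and n: "n \<le> length r + C"
  obtains X' where "emitted r v n (Suc j) X'"
    and "reaches (first_factor_program C M) (2 * C + 3)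
      (Emit (queue r v n j), Suc (length r + j), X)
      (Emit (queue r v n (Suc j)), Suc (length r + Suc j), X')"
proof -
  let ?\<delta> = "first_factor_program C M"
  let ?p = "Suc (length r + j)"
  have written: "X i = (initial_tape r i, if length r < i then Some (v ! (i - length r - 1)) else None)"
    if "i < ?p" for i using X that by (simp add: emitted_def less_Suc_eq_le)
  have pending: "fst (X i) \<noteq> LeftEnd"
    "snd (X i) = (if n + j < i \<and> i \<le> n + length v then Some (v ! (i - n - 1)) else None)"
    if "?p \<le> i" for i using X that by (simp_all add: emitted_def)
  show thesis
  proof (cases "n \<le> length r")
    case True
    \<comment> \<open>The next letter is at the head of the queue, or in the current cell if the queue is empty.\<close>
    let ?X' = "X(?p := (Blank, Some (v ! j)))"
    have "snd (X ?p) = (if j + (length r - n) < length v then Some (v ! (j + (length r - n))) else None)"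
      using pending(2)[of ?p] True by (auto simp: Suc_diff_le add.commute intro!: arg_cong[where f = "(!) v"])
    then have "enqueue (queue r v n j) (snd (X ?p)) = v ! j # queue r v n (Suc j)"
      using enqueue_queue[OF j] by simp
    then have "?\<delta> (Emit (queue r v n j)) (X ?p) = Some (Emit (queue r v n (Suc j)), (Blank, Some (v ! j)), MoveRight)"
      using pending(1)[of ?p] by (cases "X ?p") simp
    then have "reaches ?\<delta> 1 (Emit (queue r v n j), ?p, X) (Emit (queue r v n (Suc j)), Suc (length r + Suc j), ?X')"
      by (rule reaches_single) simp
    then have "reaches ?\<delta> (2 * C + 3) (Emit (queue r v n j), ?p, X)
        (Emit (queue r v n (Suc j)), Suc (length r + Suc j), ?X')"
      by (rule reaches_mono) simp
    moreover have "emitted r v n (Suc j) ?X'"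
      unfolding emitted_def using written pending True
      by (auto simp: initial_tape_blank le_Suc_eq)
    ultimately show thesis by (rule that[rotated])
  next
    case False
    \<comment> \<open>The next letter is \<open>k + 1\<close> cells to the right, with no letter on the second track
      in between.\<close>
    define k where "k = n - length r - 1"
    have k: "n = Suc (length r + k)" "k < C" using False n by (auto simp: k_def)
    have empty: "queue r v n j = []" "queue r v n (Suc j) = []" using False by (simp_all add: queue_def)
    let ?X1 = "X(?p := (Blank, None))"
    let ?X2 = "?X1(Suc ?p + k := (Blank, None))"
    let ?X3 = "?X2(?p := (Blank, Some (v ! j)))"
    have "snd (X ?p) = None" using pending(2)[of ?p] k by simp
    then have 1: "reaches ?\<delta> 1 (Emit [], ?p, X) (Fetch 1, Suc ?p, ?X1)"
      using pending(1)[of ?p]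
      by (intro reaches_single[where b = "(Blank, None)" and d = MoveRight]) (cases "X ?p"; simp add: enqueue_def)+
    have "fst (?X1 (Suc ?p + i)) \<noteq> LeftEnd \<and> snd (?X1 (Suc ?p + i)) = None" if "i < k" for i
      using pending[of "Suc ?p + i"] that k by simp
    then have 2: "reaches ?\<delta> k (Fetch 1, Suc ?p, ?X1) (Fetch (1 + k), Suc ?p + k, ?X1)"
      by (rule reaches_fetch) (use k(2) in linarith)+
    have "fst (?X1 (Suc ?p + k)) \<noteq> LeftEnd" "snd (?X1 (Suc ?p + k)) = Some (v ! j)"
      using pending[of "Suc ?p + k"] k j by simp_all
    then have 3: "reaches ?\<delta> 1 (Fetch (1 + k), Suc ?p + k, ?X1) (Carry (v ! j) k, ?p + k, ?X2)"
      by (intro reaches_single[where b = "(Blank, None)" and d = MoveLeft]) (cases "?X1 (Suc ?p + k)"; simp)+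
    have "fst (?X2 (?p + Suc i)) \<noteq> LeftEnd" if "i < k" for i
      using pending(1)[of "?p + Suc i"] by simp
    then have 4: "reaches ?\<delta> k (Carry (v ! j) k, ?p + k, ?X2) (Carry (v ! j) 0, ?p, ?X2)"
      by (rule reaches_carry)
    have "?X2 ?p = (Blank, None)" by simp
    then have 5: "reaches ?\<delta> 1 (Carry (v ! j) 0, ?p, ?X2) (Emit [], Suc (length r + Suc j), ?X3)"
      by (intro reaches_single[where b = "(Blank, Some (v ! j))" and d = MoveRight]) simp_all
    have "reaches ?\<delta> (1 + (k + (1 + (k + 1)))) (Emit [], ?p, X) (Emit [], Suc (length r + Suc j), ?X3)"
      by (intro reaches_trans[OF 1] reaches_trans[OF 2] reaches_trans[OF 3] reaches_trans[OF 4] 5)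
    then have "reaches ?\<delta> (2 * C + 3) (Emit (queue r v n j), ?p, X)
        (Emit (queue r v n (Suc j)), Suc (length r + Suc j), ?X3)"
      unfolding empty by (rule reaches_mono) (use k in simp)
    moreover have "emitted r v n (Suc j) ?X3"
      unfolding emitted_def
    proof (intro conjI allI impI)
      fix i assume i: "i \<le> length r + Suc j"
      show "?X3 i = (initial_tape r i, if length r < i then Some (v ! (i - length r - 1)) else None)"
        using i written by (auto simp: initial_tape_blank le_Suc_eq)
    next
      fix i assume i: "length r + Suc j < i"
      then show "fst (?X3 i) \<noteq> LeftEnd" using pending(1)[of i] by simp
      show "snd (?X3 i) = (if n + Suc j < i \<and> i \<le> n + length v then Some (v ! (i - n - 1)) else None)"
        using i pending(2)[of i] k by auto
    qed
    ultimately show thesis by (rule that[rotated])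
  qed
qed

lemma emit_letters:
  assumes "emitted r v n 0 X" and "n \<le> length r + C" and "j \<le> length v"
  shows "\<exists>X'. emitted r v n j X' \<and> reaches (first_factor_program C M) (j * (2 * C + 3))
    (Emit (queue r v n 0), Suc (length r), X) (Emit (queue r v n j), Suc (length r + j), X')"
  using assms(3)
proof (induction j)
  case 0
  then show ?case using assms(1) reaches.refl by fastforce
next
  case (Suc j)
  then obtain X1 where X1: "emitted r v n j X1" "reaches (first_factor_program C M) (j * (2 * C + 3))
    (Emit (queue r v n 0), Suc (length r), X) (Emit (queue r v n j), Suc (length r + j), X1)" by auto
  obtain X2 where X2: "emitted r v n (Suc j) X2"
    "reaches (first_factor_program C M) (2 * C + 3)
      (Emit (queue r v n j), Suc (length r + j), X1)
      (Emit (queue r v n (Suc j)), Suc (length r + Suc j), X2)"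
    using emit_letter[OF X1(1) _ assms(2), of M] Suc.prems by (metis Suc_le_lessD)
  from reaches_append[OF X1(2) X2(2), of "Suc j * (2 * C + 3)"] X2(1) show ?case
    by (intro exI[of _ X2]) simp
qed

lemma emit_finish:
  assumes X: "emitted r v n j X" and "queue r v n j = []" and "0 < C"
    and none: "\<And>i. length r + j < i \<Longrightarrow> i \<le> Suc (length r + j) + C \<Longrightarrow> snd (X i) = None"
  obtains q p X' where
    "reaches (first_factor_program C M) (Suc C) (Emit (queue r v n j), Suc (length r + j), X) (q, p, X')"
    and "first_factor_program C M q (X' p) = None"
    and "\<forall>i \<le> length r + j.
      X' i = (initial_tape r i, if length r < i then Some (v ! (i - length r - 1)) else None)"
    and "X' (Suc (length r + j)) = (Blank, None)"
proof -
  let ?p = "Suc (length r + j)" and ?\<delta> = "first_factor_program C M"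
  let ?X' = "X(?p := (Blank, None))"
  have ahead: "fst (X i) \<noteq> LeftEnd" if "length r + j < i" for i
    using X that by (simp add: emitted_def)
  have 1: "reaches ?\<delta> 1 (Emit [], ?p, X) (Fetch 1, Suc ?p, ?X')"
    using ahead[of ?p] none[of ?p]
    by (intro reaches_single[where b = "(Blank, None)" and d = MoveRight]) (cases "X ?p"; simp add: enqueue_def)+
  have "fst (?X' (Suc ?p + i)) \<noteq> LeftEnd \<and> snd (?X' (Suc ?p + i)) = None" if "i < C" for i
    using ahead[of "Suc ?p + i"] none[of "Suc ?p + i"] that by simp
  then have cells: "\<And>i. i < C \<Longrightarrow> fst (?X' (Suc ?p + i)) \<noteq> LeftEnd \<and> snd (?X' (Suc ?p + i)) = None" .
  have 2: "reaches ?\<delta> (C - 1) (Fetch 1, Suc ?p, ?X') (Fetch (1 + (C - 1)), Suc ?p + (C - 1), ?X')"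
    by (rule reaches_fetch) (use cells \<open>0 < C\<close> in auto)
  have "reaches ?\<delta> (Suc C) (Emit (queue r v n j), ?p, X) (Fetch (1 + (C - 1)), Suc ?p + (C - 1), ?X')"
    unfolding \<open>queue r v n j = []\<close> by (rule reaches_append[OF 1 2]) simp
  moreover have "?\<delta> (Fetch (1 + (C - 1))) (?X' (Suc ?p + (C - 1))) = None"
    using cells[of "C - 1"] \<open>0 < C\<close> by (cases "?X' (Suc ?p + (C - 1))") simp
  moreover have "\<forall>i \<le> length r + j.
      ?X' i = (initial_tape r i, if length r < i then Some (v ! (i - length r - 1)) else None)"
    using X by (simp add: emitted_def)
  moreover have "?X' ?p = (Blank, None)" by simp
  ultimately show thesis by (rule that)
qed

lemma copy_first_factor:
  assumes X: "\<And>i. X i = (T i, if n < i \<and> i \<le> n + length v then Some (v ! (i - n - 1)) else None)"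
    and T: "output_prefix r T" "\<And>i. T i = LeftEnd \<longleftrightarrow> i = 0" and r: "length r \<le> n + C"
  obtains X' where "emitted r v n 0 X'"
    and "reaches (first_factor_program C M) (length r + 1)
      (Copy [], 1, X) (Emit (queue r v n 0), Suc (length r), X')"
proof -
  let ?\<delta> = "first_factor_program C M"
  define Y where "Y k i = (if 0 < i \<and> i \<le> k then (T i, None) else X i)" for k i
  have copy: "reaches ?\<delta> k (Copy [], 1, X) (Copy (take (k - n) v), Suc k, Y k)" if "k \<le> length r" for k
    using that
  proof (induction k)
    case 0
    have "Y 0 = X" by (auto simp: Y_def fun_eq_iff)
    then show ?case by (simp add: reaches.refl)
  next
    case (Suc k)
    let ?w = "if n \<le> k \<and> k < n + length v then Some (v ! (k - n)) else None"
    have q: "enqueue (take (k - n) v) ?w = take (Suc k - n) v"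
      by (auto simp: enqueue_def Suc_diff_le take_Suc_conv_app_nth not_le)
    have "Y k (Suc k) = (Letter (r ! k), ?w)"
      using T(1) Suc.prems by (auto simp: Y_def X output_prefix_def)
    moreover have "length (take (Suc k - n) v) \<le> C" using Suc.prems r by simp
    ultimately have \<delta>: "?\<delta> (Copy (take (k - n) v)) (Y k (Suc k))
        = Some (Copy (take (Suc k - n) v), (Letter (r ! k), None), MoveRight)"
      by (simp only: first_factor_program.simps cell.case q if_True)
    have upd: "(Y k)(Suc k := (Letter (r ! k), None)) = Y (Suc k)"
      using T(1) Suc.prems by (auto simp: Y_def fun_eq_iff output_prefix_def le_Suc_eq)
    from \<delta> have "reaches ?\<delta> 1 (Copy (take (k - n) v), Suc k, Y k)
        (Copy (take (Suc k - n) v), Suc (Suc k), Y (Suc k))"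
      by (rule reaches_single) (simp add: upd)
    from reaches_trans[OF Suc.IH this] Suc.prems show ?case by simp
  qed
  let ?X' = "Y (length r)"
  have "fst (?X' (Suc (length r))) = Blank"
    using T(1) by (simp add: Y_def X output_prefix_def)
  then have "?\<delta> (Copy (take (length r - n) v)) (?X' (Suc (length r)))
      = Some (Emit (queue r v n 0), ?X' (Suc (length r)), Stay)"
    by (cases "?X' (Suc (length r))") (simp add: queue_def)
  then have "reaches ?\<delta> 1 (Copy (take (length r - n) v), Suc (length r), ?X')
      (Emit (queue r v n 0), Suc (length r), ?X')"
    by (rule reaches_single) (simp only: apply_move.simps fun_upd_triv)
  from reaches_trans[OF copy[OF order_refl] this]
  have "reaches ?\<delta> (length r + 1) (Copy [], 1, X) (Emit (queue r v n 0), Suc (length r), ?X')" .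
  moreover have "emitted r v n 0 ?X'"
    using T unfolding emitted_def output_prefix_iff_initial_tape by (auto simp: Y_def X)
  ultimately show thesis by (rule that[rotated])
qed

text \<open>
  The second factor moves by the difference of the lengths of \<open>f u\<close> and \<open>u\<close>, at a cost proportional
  to this distance for each of its letters. How far \<open>f u\<close> exceeds \<open>u\<close> is bounded anyway, but it may
  fall short of \<open>u\<close> by any amount. The machine therefore gives up on differences larger than a
  constant and leaves just \<open>f u\<close>, in order to work in linear time on all inputs.
\<close>

lemma pf_linear_time_computable_first_factor:
  fixes f :: "'s list \<Rightarrow> 's list"
  assumes f: "pf_linear_time_computable A f" and disj: "A \<inter> B = {}" and "finite B"
  obtains F where "pf_linear_time_computable (A \<union> B) F"
    and "\<And>u v. \<lbrakk>u \<in> lists A; v \<in> lists B; length u \<le> length (f u) + C\<^sub>0\<rbrakk> \<Longrightarrow> F (u @ v) = f u @ v"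
proof -
  obtain M c d where M: "pf_machine A M"
    and out: "\<And>x. x \<in> lists A \<Longrightarrow> outputs_within M x (f x) (c * length x + d)"
    and f_lists: "f \<in> lists A \<rightarrow> lists A"
    using f unfolding pf_linear_time_computable_def by blast
  obtain C\<^sub>1 where C\<^sub>1: "\<And>u. u \<in> lists A \<Longrightarrow> length (f u) \<le> length u + C\<^sub>1"
    by (rule pf_linear_time_output_length[OF f]) blast
  \<comment> \<open>A fetch examines one cell before it compares its distance with \<open>C\<close>, which must be positive for
    \<open>C\<close> to be the exact limit.\<close>
  define C where "C = Suc (C\<^sub>0 + C\<^sub>1)"
  have C: "0 < C" "C\<^sub>0 \<le> C" and grow: "\<And>u. u \<in> lists A \<Longrightarrow> length (f u) \<le> length u + C"
    using C\<^sub>1 by (fastforce simp: C_def)+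
  let ?enc = "first_factor_symbol A"
  let ?\<delta> = "first_factor_program C M"
  define j where "j u v = (if length u \<le> length (f u) + C then length v else 0)" for u v :: "'s list"
  define F\<^sub>0 where "F\<^sub>0 u v = f u @ take (j u v) v" for u v
  have lists: "F\<^sub>0 u v \<in> lists (A \<union> B)" if "u \<in> lists A" "v \<in> lists B" for u v
  proof -
    have "f u \<in> lists A" using that f_lists by blast
    then show ?thesis using that by (auto simp: F\<^sub>0_def dest: in_set_takeD)
  qed
  \<comment> \<open>The simulation and the way back take \<open>c * length u + d\<close> steps each, copying \<open>f u\<close> at most
    \<open>length u + C + 1\<close> steps, and each letter of \<open>v\<close> at most \<open>2 * C + 3\<close> steps.\<close>
  let ?c = "2 * c + 2 * C + 4" and ?d = "2 * d + 2 * C + 5"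
  have computes: "computes_within ?\<delta> (Simulate (start M)) ?enc (u @ v) (F\<^sub>0 u v)
      (?c * length (u @ v) + ?d)"
    if u: "u \<in> lists A" and v: "v \<in> lists B" for u v
  proof -
    let ?n = "length u" and ?r = "f u" and ?t = "c * length u + d" and ?j = "j u v"
    have r: "?r \<in> lists A" using u f_lists by blast
    define X where "X i = ?enc (initial_tape (u @ v) i)" for i
    have X: "X i = (initial_tape u i,
        if ?n < i \<and> i \<le> ?n + length v then Some (v ! (i - ?n - 1)) else None)" for i
      unfolding X_def by (rule first_factor_symbol_initial_tape[OF u v disj])
    obtain q' p' T' where run: "reaches (trans M) ?t (start M, 0, initial_tape u) (q', p', T')"
      and halt: "trans M q' (T' p') = None" and T': "output_prefix ?r T'"
      by (rule outputs_withinE[OF out[OF u]])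
    have \<delta>: "?\<delta> (Simulate q) (m, w) = Some (Simulate q', (m', w), d)" if "trans M q m = Some (q', m', d)"
      for q q' m m' w d using that by simp
    define Z where "Z = overlay 0 X T'"
    have Z: "Z i = (T' i, if ?n < i \<and> i \<le> ?n + length v then Some (v ! (i - ?n - 1)) else None)" for i
      by (simp add: Z_def overlay_def X)
    have "range (initial_tape u) \<subseteq> symbols M"
      using initial_tape_in_io_cells[OF u] pf_machineD(4)[OF M] by blast
    from reaches_overlay[OF M, of ?\<delta> Simulate, OF \<delta> run pf_machineD(2)[OF M] this, of 0 X]
    have sim: "reaches ?\<delta> ?t (Simulate (start M), 0, overlay 0 X (initial_tape u)) (Simulate q', p', Z)"
      and T'_LeftEnd: "\<And>i. T' i = LeftEnd \<longleftrightarrow> i = 0" by (simp_all add: Z_def)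
    have "overlay 0 X (initial_tape u) = X" by (auto simp: overlay_def X fun_eq_iff)
    with sim have 1: "reaches ?\<delta> ?t (Simulate (start M), 0, X) (Simulate q', p', Z)" by simp
    have "?\<delta> (Simulate q') (Z p') = Some (Return, Z p', Stay)" using halt by (simp add: Z)
    then have 2: "reaches ?\<delta> 1 (Simulate q', p', Z) (Return, p', Z)" by (rule reaches_single) simp
    have "reaches ?\<delta> p' (Return, 0 + p', Z) (Return, 0, Z)"
      by (rule reaches_sweep_left[where s = "\<lambda>_. Return"]) (simp add: Z T'_LeftEnd)
    moreover have "p' \<le> ?t" using reaches_position[OF run] by simp
    ultimately have 3: "reaches ?\<delta> ?t (Return, p', Z) (Return, 0, Z)" by (simp add: reaches_mono)
    have "?\<delta> Return (Z 0) = Some (Copy [], Z 0, MoveRight)" using T'_LeftEnd[of 0] by (simp add: Z)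
    then have 4: "reaches ?\<delta> 1 (Return, 0, Z) (Copy [], 1, Z)" by (rule reaches_single) simp
    obtain Y where Y: "emitted ?r v ?n 0 Y"
      and 5: "reaches ?\<delta> (length ?r + 1) (Copy [], 1, Z) (Emit (queue ?r v ?n 0), Suc (length ?r), Y)"
      by (rule copy_first_factor[where M = M, OF Z T' T'_LeftEnd grow[OF u]])
    have j: "?j \<le> length v" by (simp add: j_def)
    have "\<exists>Y'. emitted ?r v ?n ?j Y' \<and> reaches ?\<delta> (?j * (2 * C + 3))
        (Emit (queue ?r v ?n 0), Suc (length ?r), Y) (Emit (queue ?r v ?n ?j), Suc (length ?r + ?j), Y')"
    proof (cases "?n \<le> length ?r + C")
      case True
      show ?thesis by (rule emit_letters[OF Y True j])
    next
      case False
      then have "?j = 0" by (simp add: j_def)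
      then show ?thesis using Y reaches.refl by fastforce
    qed
    then obtain Y' where Y': "emitted ?r v ?n ?j Y'" and 6: "reaches ?\<delta> (?j * (2 * C + 3))
        (Emit (queue ?r v ?n 0), Suc (length ?r), Y) (Emit (queue ?r v ?n ?j), Suc (length ?r + ?j), Y')"
      by blast
    have empty: "queue ?r v ?n ?j = []" by (auto simp: queue_def j_def)
    have none: "snd (Y' i) = None" if "length ?r + ?j < i" "i \<le> Suc (length ?r + ?j) + C" for i
      using Y' that by (auto simp: emitted_def j_def split: if_splits)
    obtain q p W where
      7: "reaches ?\<delta> (Suc C) (Emit (queue ?r v ?n ?j), Suc (length ?r + ?j), Y') (q, p, W)"
      and W: "?\<delta> q (W p) = None"
      "\<forall>i \<le> length ?r + ?j.
        W i = (initial_tape ?r i, if length ?r < i then Some (v ! (i - length ?r - 1)) else None)"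
      "W (Suc (length ?r + ?j)) = (Blank, None)"
      by (rule emit_finish[where M = M, OF Y' empty C(1) none])
    have total: "reaches ?\<delta> (?t + (1 + (?t + (1 + ((length ?r + 1) + (?j * (2 * C + 3) + Suc C))))))
        (Simulate (start M), 0, X) (q, p, W)"
      by (intro reaches_trans[OF 1] reaches_trans[OF 2] reaches_trans[OF 3] reaches_trans[OF 4]
          reaches_trans[OF 5] reaches_trans[OF 6] 7)
    have "?j * (2 * C + 3) \<le> length v * (2 * C + 3)" using j by (rule mult_le_mono1)
    then have "?t + (1 + (?t + (1 + ((length ?r + 1) + (?j * (2 * C + 3) + Suc C)))))
        \<le> ?t + (1 + (?t + (1 + ((?n + C + 1) + (length v * (2 * C + 3) + Suc C)))))"
      using grow[OF u] by linarith
    also have "\<dots> \<le> ?c * length (u @ v) + ?d" by (simp add: algebra_simps)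
    finally have "reaches ?\<delta> (?c * length (u @ v) + ?d) (Simulate (start M), 0, X) (q, p, W)"
      by (rule reaches_mono[OF total])
    moreover have "\<forall>i \<le> Suc (length (F\<^sub>0 u v)). W i = ?enc (initial_tape (F\<^sub>0 u v) i)"
    proof (intro allI impI)
      fix i assume "i \<le> Suc (length (F\<^sub>0 u v))"
      then have i: "i \<le> length ?r + ?j \<or> i = Suc (length ?r + ?j)" using j by (auto simp: F\<^sub>0_def)
      have "take ?j v \<in> lists B" using v by (auto dest: in_set_takeD)
      then have "?enc (initial_tape (F\<^sub>0 u v) i) = (initial_tape ?r i,
          if length ?r < i \<and> i \<le> length ?r + ?j then Some (take ?j v ! (i - length ?r - 1)) else None)"
        unfolding F\<^sub>0_def using first_factor_symbol_initial_tape[OF r _ disj, of "take ?j v" i] j by simp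
      then show "W i = ?enc (initial_tape (F\<^sub>0 u v) i)"
        using i W(2)[rule_format, of i] W(3) by (auto simp: initial_tape_blank)
    qed
    ultimately show ?thesis using W(1) unfolding computes_within_def X_def[abs_def] by (intro exI conjI)
  qed
  obtain M' where M': "pf_machine (A \<union> B) M'"
    and out': "\<And>x y n. x \<in> lists (A \<union> B) \<Longrightarrow> y \<in> lists (A \<union> B)
      \<Longrightarrow> computes_within ?\<delta> (Simulate (start M)) ?enc x y n \<Longrightarrow> outputs_within M' x y n"
    by (rule pf_program_realizable[OF pf_program_first_factor[OF M \<open>finite B\<close> C(1)]]) blast
  obtain F where F: "pf_linear_time_computable (A \<union> B) F"
    and F_eq: "\<And>u v. u \<in> lists A \<Longrightarrow> v \<in> lists B \<Longrightarrow> F (u @ v) = F\<^sub>0 u v"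
  proof (rule pf_linear_time_computable_from_factors[OF disj M' _ lists])
    fix u v assume uv: "u \<in> lists A" "v \<in> lists B"
    then have "u @ v \<in> lists (A \<union> B)" by auto
    then show "outputs_within M' (u @ v) (F\<^sub>0 u v) (?c * length (u @ v) + ?d)"
      using out' lists[OF uv] computes[OF uv] by blast
  qed (assumption+, rule that)
  from F show thesis
  proof (rule that)
    fix u v assume uv: "u \<in> lists A" "v \<in> lists B" and "length u \<le> length (f u) + C\<^sub>0"
    then have "j u v = length v" using C(2) by (simp add: j_def)
    then show "F (u @ v) = f u @ v" using F_eq[OF uv] by (simp add: F\<^sub>0_def)
  qed
qed

section \<open>Direct products of groups\<close>

lemma products_in_carrier: "\<lbrakk>g \<in> products G S; S \<subseteq> carrier G; group G\<rbrakk> \<Longrightarrow> g \<in> carrier G"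
  by (induction rule: products.induct) (auto intro: group.is_monoid monoid.m_closed)

text \<open>
  Multiplication by a fixed group element lengthens representatives by a bounded amount, for it
  amounts to a bounded number of multiplications by generators.
\<close>

lemma length_le_of_products:
  fixes \<psi> :: "'s list \<Rightarrow> 'a"
  assumes G: "group G" and S: "S \<subseteq> carrier G" and \<psi>: "bij_betw \<psi> L (carrier G)" and L: "L \<subseteq> lists \<Sigma>"
    and f: "\<And>s. s \<in> S \<Longrightarrow> pf_linear_time_computable \<Sigma> (f s) \<and> f s ` L \<subseteq> L
        \<and> (\<forall>w \<in> L. \<psi> (f s w) = \<psi> w \<otimes>\<^bsub>G\<^esub> s)"
    and g: "g \<in> products G S"
  shows "\<exists>C. \<forall>w \<in> L. \<forall>w' \<in> L. \<psi> w' = \<psi> w \<otimes>\<^bsub>G\<^esub> g \<longrightarrow> length w' \<le> length w + C"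
  using g
proof induction
  case (single s)
  obtain C where C: "\<And>u. u \<in> lists \<Sigma> \<Longrightarrow> length (f s u) \<le> length u + C"
    by (rule pf_linear_time_output_length) (use f[OF single] in blast)+
  have "length w' \<le> length w + C" if "w \<in> L" "w' \<in> L" "\<psi> w' = \<psi> w \<otimes>\<^bsub>G\<^esub> s" for w w'
  proof -
    have "\<psi> (f s w) = \<psi> w'" "f s w \<in> L" using f[OF single] that by auto
    then have "f s w = w'" using \<psi> \<open>w' \<in> L\<close> by (auto simp: bij_betw_def inj_on_def)
    then show ?thesis using C[of w] \<open>w \<in> L\<close> L by auto
  qed
  then show ?case by blast
next
  case (mult g s)
  obtain C\<^sub>1 where C\<^sub>1: "\<And>w w'. \<lbrakk>w \<in> L; w' \<in> L; \<psi> w' = \<psi> w \<otimes>\<^bsub>G\<^esub> g\<rbrakk> \<Longrightarrow> length w' \<le> length w + C\<^sub>1"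
    using mult.IH by blast
  obtain C\<^sub>2 where C\<^sub>2: "\<And>u. u \<in> lists \<Sigma> \<Longrightarrow> length (f s u) \<le> length u + C\<^sub>2"
    by (rule pf_linear_time_output_length) (use f[OF mult.hyps(2)] in blast)+
  have "length w' \<le> length w + (C\<^sub>1 + C\<^sub>2)"
    if w: "w \<in> L" "w' \<in> L" "\<psi> w' = \<psi> w \<otimes>\<^bsub>G\<^esub> (g \<otimes>\<^bsub>G\<^esub> s)" for w w'
  proof -
    have car: "g \<in> carrier G" "s \<in> carrier G" "\<psi> w \<in> carrier G"
      using products_in_carrier[OF mult.hyps(1) S G] mult.hyps(2) S \<psi> w(1) by (auto simp: bij_betw_def)
    then have "\<psi> w \<otimes>\<^bsub>G\<^esub> g \<in> carrier G" using G by (simp add: group.is_monoid monoid.m_closed)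
    then obtain w'' where w'': "w'' \<in> L" "\<psi> w'' = \<psi> w \<otimes>\<^bsub>G\<^esub> g"
      using \<psi> by (metis bij_betw_imp_surj_on imageE)
    have "\<psi> (f s w'') = \<psi> w'" "f s w'' \<in> L"
      using f[OF mult.hyps(2)] w'' w(3) car G by (auto simp: group.is_monoid monoid.m_assoc)
    then have "f s w'' = w'" using \<psi> \<open>w' \<in> L\<close> by (auto simp: bij_betw_def inj_on_def)
    then show ?thesis using C\<^sub>1[OF w(1) w''] C\<^sub>2[OF subsetD[OF L w''(1)]] by simp
  qed
  then show ?case by blast
qed

text \<open>
  A pair \<open>(g, h)\<close> is reached by multiplying with generators of \<open>G\<close> first and with generators of \<open>H\<close>
  afterwards. At least one of either kind is used, which is possible even for neutral elements,
  since they are nonempty products of generators, too.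
\<close>

lemma semigroup_generators_DirProd:
  assumes G: "group G" "semigroup_generators G S" and H: "group H" "semigroup_generators H T"
  shows "semigroup_generators (G \<times>\<times> H) ((\<lambda>s. (s, \<one>\<^bsub>H\<^esub>)) ` S \<union> Pair \<one>\<^bsub>G\<^esub> ` T)"
proof -
  let ?U = "(\<lambda>s. (s, \<one>\<^bsub>H\<^esub>)) ` S \<union> Pair \<one>\<^bsub>G\<^esub> ` T"
  interpret G: group G by fact
  interpret H: group H by fact
  have S: "finite S" "S \<subseteq> carrier G" "carrier G \<subseteq> products G S"
    and T: "finite T" "T \<subseteq> carrier H" "carrier H \<subseteq> products H T"
    using G H by (auto simp: semigroup_generators_def)
  have first: "(g, \<one>\<^bsub>H\<^esub>) \<in> products (G \<times>\<times> H) ?U" if "g \<in> products G S" for g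
    using that
  proof induction
    case (single s)
    then show ?case by (intro products.single) simp
  next
    case (mult g s)
    have "(g, \<one>\<^bsub>H\<^esub>) \<otimes>\<^bsub>G \<times>\<times> H\<^esub> (s, \<one>\<^bsub>H\<^esub>) \<in> products (G \<times>\<times> H) ?U"
      using mult by (intro products.mult) auto
    then show ?case by simp
  qed
  have "(g, h) \<in> products (G \<times>\<times> H) ?U" if g: "g \<in> carrier G" and "h \<in> products H T" for g h
    using that(2)
  proof induction
    case (single t)
    have "(g, \<one>\<^bsub>H\<^esub>) \<otimes>\<^bsub>G \<times>\<times> H\<^esub> (\<one>\<^bsub>G\<^esub>, t) \<in> products (G \<times>\<times> H) ?U"
      using single first g S(3) by (intro products.mult) auto
    then show ?case using g single T(2) by auto
  next
    case (mult h t)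
    have "(g, h) \<otimes>\<^bsub>G \<times>\<times> H\<^esub> (\<one>\<^bsub>G\<^esub>, t) \<in> products (G \<times>\<times> H) ?U"
      using mult by (intro products.mult) auto
    then show ?case using g by simp
  qed
  then show ?thesis using S T by (auto simp: semigroup_generators_def)
qed

definition cayley_representation ::
    "'s list set set \<Rightarrow> ('a, 'm) monoid_scheme \<Rightarrow> 'a set \<Rightarrow> 's set \<Rightarrow> 's list set \<Rightarrow>
     ('s list \<Rightarrow> 'a) \<Rightarrow> ('a \<Rightarrow> 's list \<Rightarrow> 's list) \<Rightarrow> bool" where
  "cayley_representation \<C> G S \<Sigma> L \<psi> f \<longleftrightarrow>
     semigroup_generators G S \<and> finite \<Sigma> \<and> L \<subseteq> lists \<Sigma> \<and> L \<in> \<C> \<and> bij_betw \<psi> L (carrier G) \<and>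
     (\<forall>s \<in> S. pf_linear_time_computable \<Sigma> (f s) \<and> f s ` L \<subseteq> L \<and>
        (\<forall>w \<in> L. \<psi> (f s w) = \<psi> w \<otimes>\<^bsub>G\<^esub> s))"

lemma cayley_pf_linear_time_iff:
  "cayley_pf_linear_time \<C> G \<longleftrightarrow> group G \<and> (\<exists>S \<Sigma> L \<psi> f. cayley_representation \<C> G S \<Sigma> L \<psi> f)"
  unfolding cayley_pf_linear_time_def cayley_representation_def
  by (intro arg_cong2[where f = "(\<and>)"] HOL.refl iffI;
      elim exE conjE; intro exI conjI; assumption)

lemma cayley_representation_rename:
  fixes \<xi> :: "'s \<Rightarrow> 's"
  assumes rep: "cayley_representation \<C> G S \<Sigma> L \<psi> f" and \<C>: "closed_under_symbol_change \<C>"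
    and \<xi>: "bij_betw \<xi> \<Sigma> \<Sigma>'" and "finite \<Sigma>'"
  shows "cayley_representation \<C> G S \<Sigma>' (map \<xi> ` L) (\<lambda>w. \<psi> (map (inv_into \<Sigma> \<xi>) w))
    (\<lambda>s w. map \<xi> (f s (map (inv_into \<Sigma> \<xi>) w)))"
proof -
  have S: "semigroup_generators G S" and fin: "finite \<Sigma>" and L: "L \<subseteq> lists \<Sigma>" "L \<in> \<C>"
    and \<psi>: "bij_betw \<psi> L (carrier G)"
    and f: "\<And>s. s \<in> S \<Longrightarrow> pf_linear_time_computable \<Sigma> (f s)" "\<And>s. s \<in> S \<Longrightarrow> f s ` L \<subseteq> L"
      "\<And>s w. s \<in> S \<Longrightarrow> w \<in> L \<Longrightarrow> \<psi> (f s w) = \<psi> w \<otimes>\<^bsub>G\<^esub> s"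
    using rep unfolding cayley_representation_def by auto
  have inv: "map (inv_into \<Sigma> \<xi>) (map \<xi> w) = w" if "w \<in> L" for w
    using that L(1) by (intro map_inv_into_map[OF \<xi>]) blast
  have "map \<xi> ` L \<in> \<C>"
    using \<C> fin \<open>finite \<Sigma>'\<close> \<xi> L unfolding closed_under_symbol_change_def by blast
  moreover have "map \<xi> ` L \<subseteq> lists \<Sigma>'"
    using L(1) \<xi> by (intro image_subsetI map_in_lists[of _ \<Sigma>]) (auto simp: bij_betw_def)
  moreover have "bij_betw (\<lambda>w. \<psi> (map (inv_into \<Sigma> \<xi>) w)) (map \<xi> ` L) (carrier G)"
  proof -
    have "bij_betw (map (inv_into \<Sigma> \<xi>)) (map \<xi> ` L) L"
      by (rule bij_betw_byWitness[where f' = "map \<xi>"]) (auto simp: inv simp del: map_map)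
    from bij_betw_trans[OF this \<psi>] show ?thesis by (simp add: comp_def)
  qed
  moreover have "pf_linear_time_computable \<Sigma>' (\<lambda>w. map \<xi> (f s (map (inv_into \<Sigma> \<xi>) w)))
      \<and> (\<lambda>w. map \<xi> (f s (map (inv_into \<Sigma> \<xi>) w))) ` (map \<xi> ` L) \<subseteq> map \<xi> ` L
      \<and> (\<forall>w \<in> map \<xi> ` L. \<psi> (map (inv_into \<Sigma> \<xi>) (map \<xi> (f s (map (inv_into \<Sigma> \<xi>) w))))
          = \<psi> (map (inv_into \<Sigma> \<xi>) w) \<otimes>\<^bsub>G\<^esub> s)" if s: "s \<in> S" for s
  proof (intro conjI ballI subsetI)
    show "pf_linear_time_computable \<Sigma>' (\<lambda>w. map \<xi> (f s (map (inv_into \<Sigma> \<xi>) w)))"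
      by (rule pf_linear_time_computable_rename[OF f(1)[OF s] \<xi>])
  next
    fix w' assume "w' \<in> (\<lambda>w. map \<xi> (f s (map (inv_into \<Sigma> \<xi>) w))) ` (map \<xi> ` L)"
    then obtain w where "w \<in> L" "w' = map \<xi> (f s w)" using inv by auto
    then show "w' \<in> map \<xi> ` L" using f(2)[OF s] by blast
  next
    fix w' assume "w' \<in> map \<xi> ` L"
    then obtain w where w: "w \<in> L" "w' = map \<xi> w" by blast
    then have "f s w \<in> L" using f(2)[OF s] by blast
    then show "\<psi> (map (inv_into \<Sigma> \<xi>) (map \<xi> (f s (map (inv_into \<Sigma> \<xi>) w'))))
        = \<psi> (map (inv_into \<Sigma> \<xi>) w') \<otimes>\<^bsub>G\<^esub> s"
      using f(3)[OF s w(1)] by (simp only: w(2) inv[OF w(1)] inv)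
  qed
  ultimately show ?thesis
    unfolding cayley_representation_def using S \<open>finite \<Sigma>'\<close> by blast
qed

lemma bij_betw_concat:
  assumes \<psi>: "bij_betw \<psi> L X" and \<phi>: "bij_betw \<phi> K Y"
    and L: "L \<subseteq> lists A" and K: "K \<subseteq> lists B" and disj: "A \<inter> B = {}"
  obtains \<theta> where "bij_betw \<theta> {u @ v | u v. u \<in> L \<and> v \<in> K} (X \<times> Y)"
    and "\<And>u v. u \<in> L \<Longrightarrow> v \<in> K \<Longrightarrow> \<theta> (u @ v) = (\<psi> u, \<phi> v)"
proof -
  define \<theta> where "\<theta> w = (\<psi> (takeWhile (\<lambda>a. a \<in> A) w), \<phi> (dropWhile (\<lambda>a. a \<in> A) w))" for w
  have \<theta>: "\<theta> (u @ v) = (\<psi> u, \<phi> v)" if "u \<in> L" "v \<in> K" for u v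
  proof -
    have "u \<in> lists A" "v \<in> lists B" using that L K by auto
    moreover from this have "takeWhile (\<lambda>a. a \<in> A) v = []" "dropWhile (\<lambda>a. a \<in> A) v = v"
      using disj by (cases v; auto)+
    ultimately show ?thesis
      by (simp add: \<theta>_def takeWhile_append dropWhile_append in_lists_conv_set)
  qed
  have "bij_betw \<theta> {u @ v | u v. u \<in> L \<and> v \<in> K} (X \<times> Y)"
    unfolding bij_betw_def
  proof
    show "inj_on \<theta> {u @ v | u v. u \<in> L \<and> v \<in> K}"
      using \<psi> \<phi> by (auto simp: inj_on_def \<theta> bij_betw_def)
    show "\<theta> ` {u @ v | u v. u \<in> L \<and> v \<in> K} = X \<times> Y"
    proof
      show "\<theta> ` {u @ v | u v. u \<in> L \<and> v \<in> K} \<subseteq> X \<times> Y"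
        using \<psi> \<phi> by (auto simp: \<theta> bij_betw_def)
      show "X \<times> Y \<subseteq> \<theta> ` {u @ v | u v. u \<in> L \<and> v \<in> K}"
      proof
        fix z assume "z \<in> X \<times> Y"
        then obtain u v where uv: "u \<in> L" "v \<in> K" and "z = (\<psi> u, \<phi> v)"
          using \<psi> \<phi> by (auto simp: bij_betw_def)
        then have "z = \<theta> (u @ v)" by (simp add: \<theta>)
        then show "z \<in> \<theta> ` {u @ v | u v. u \<in> L \<and> v \<in> K}" using uv by blast
      qed
    qed
  qed
  then show thesis using \<theta> by (rule that)
qed

text \<open>
  The inverse of a generator \<open>s\<close> of \<open>G\<close> undoes the action of \<open>s\<close>, so the constant belonging to this
  inverse bounds how much that action shortens a representative. Hence the
  second factor only has to move over a bounded distance.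
\<close>

lemma cayley_representation_DirProd:
  assumes \<C>: "closed_under_disjoint_concat \<C>"
    and G: "group G" "cayley_representation \<C> G S A L \<psi> f"
    and H: "group H" "cayley_representation \<C> H T B K \<phi> g"
    and disj: "A \<inter> B = {}"
  shows "cayley_pf_linear_time \<C> (G \<times>\<times> H)"
proof -
  have S: "semigroup_generators G S" and finA: "finite A" and L: "L \<subseteq> lists A" "L \<in> \<C>"
    and \<psi>: "bij_betw \<psi> L (carrier G)"
    and f: "\<And>s. s \<in> S \<Longrightarrow> pf_linear_time_computable A (f s) \<and> f s ` L \<subseteq> L
      \<and> (\<forall>w \<in> L. \<psi> (f s w) = \<psi> w \<otimes>\<^bsub>G\<^esub> s)"
    using G(2) unfolding cayley_representation_def by auto
  have T: "semigroup_generators H T" and finB: "finite B" and K: "K \<subseteq> lists B" "K \<in> \<C>"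
    and \<phi>: "bij_betw \<phi> K (carrier H)"
    and g: "\<And>t. t \<in> T \<Longrightarrow> pf_linear_time_computable B (g t) \<and> g t ` K \<subseteq> K
      \<and> (\<forall>w \<in> K. \<phi> (g t w) = \<phi> w \<otimes>\<^bsub>H\<^esub> t)"
    using H(2) unfolding cayley_representation_def by auto
  have S_carrier: "S \<subseteq> carrier G" and T_carrier: "T \<subseteq> carrier H"
    using S T by (auto simp: semigroup_generators_def)
  let ?LK = "{u @ v | u v. u \<in> L \<and> v \<in> K}"
  obtain \<theta> where \<theta>: "bij_betw \<theta> ?LK (carrier G \<times> carrier H)"
    and \<theta>_append: "\<And>u v. u \<in> L \<Longrightarrow> v \<in> K \<Longrightarrow> \<theta> (u @ v) = (\<psi> u, \<phi> v)"
    by (rule bij_betw_concat[OF \<psi> \<phi> L(1) K(1) disj]) blast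
  let ?acts = "\<lambda>z F. pf_linear_time_computable (A \<union> B) F \<and> F ` ?LK \<subseteq> ?LK
    \<and> (\<forall>w \<in> ?LK. \<theta> (F w) = \<theta> w \<otimes>\<^bsub>G \<times>\<times> H\<^esub> z)"
  have first: "\<exists>F. ?acts (s, \<one>\<^bsub>H\<^esub>) F" if s: "s \<in> S" for s
  proof -
    have inv: "inv\<^bsub>G\<^esub> s \<in> products G S"
      using s S group.inv_closed[OF G(1), of s] by (auto simp: semigroup_generators_def)
    obtain C where C: "\<And>w w'. \<lbrakk>w \<in> L; w' \<in> L; \<psi> w' = \<psi> w \<otimes>\<^bsub>G\<^esub> inv\<^bsub>G\<^esub> s\<rbrakk> \<Longrightarrow> length w' \<le> length w + C"
      using length_le_of_products[OF G(1) S_carrier \<psi> L(1) f inv] by blast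
    have short: "length u \<le> length (f s u) + C" if "u \<in> L" for u
    proof (rule C)
      show "f s u \<in> L" using f[OF s] that by blast
      have "\<psi> u \<in> carrier G" "s \<in> carrier G" using \<psi> that s S_carrier by (auto simp: bij_betw_def)
      then show "\<psi> u = \<psi> (f s u) \<otimes>\<^bsub>G\<^esub> inv\<^bsub>G\<^esub> s"
        using f[OF s] that G(1) by (simp add: group.is_monoid monoid.m_assoc group.r_inv)
    qed (fact that)
    obtain F where F: "pf_linear_time_computable (A \<union> B) F"
      "\<And>u v. \<lbrakk>u \<in> lists A; v \<in> lists B; length u \<le> length (f s u) + C\<rbrakk> \<Longrightarrow> F (u @ v) = f s u @ v"
      by (rule pf_linear_time_computable_first_factor[OF _ disj finB]) (use f[OF s] in blast)+
    have F_append: "F (u @ v) = f s u @ v" if "u \<in> L" "v \<in> K" for u v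
      using F(2)[of u v] short that L(1) K(1) by blast
    have f_L: "f s u \<in> L" "\<psi> (f s u) = \<psi> u \<otimes>\<^bsub>G\<^esub> s" if "u \<in> L" for u using f[OF s] that by auto
    have one: "\<phi> v \<otimes>\<^bsub>H\<^esub> \<one>\<^bsub>H\<^esub> = \<phi> v" if "v \<in> K" for v
      using bij_betwE[OF \<phi>] that H(1) by (simp add: group.is_monoid monoid.r_one)
    have "?acts (s, \<one>\<^bsub>H\<^esub>) F"
    proof (intro conjI ballI subsetI)
      fix w assume "w \<in> F ` ?LK"
      then obtain u v where "u \<in> L" "v \<in> K" "w = f s u @ v" using F_append by auto
      then show "w \<in> ?LK" using f_L(1) by blast
    next
      fix w assume "w \<in> ?LK"
      then show "\<theta> (F w) = \<theta> w \<otimes>\<^bsub>G \<times>\<times> H\<^esub> (s, \<one>\<^bsub>H\<^esub>)" by (auto simp: F_append \<theta>_append f_L one)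
    qed (rule F(1))
    then show ?thesis by (rule exI[of "?acts (s, \<one>\<^bsub>H\<^esub>)" F])
  qed
  have second: "\<exists>F. ?acts (\<one>\<^bsub>G\<^esub>, t) F" if t: "t \<in> T" for t
  proof -
    obtain F where F: "pf_linear_time_computable (A \<union> B) F"
      "\<And>u v. \<lbrakk>u \<in> lists A; v \<in> lists B\<rbrakk> \<Longrightarrow> F (u @ v) = u @ g t v"
      by (rule pf_linear_time_computable_second_factor[OF _ disj finA]) (use g[OF t] in blast)+
    have F_append: "F (u @ v) = u @ g t v" if "u \<in> L" "v \<in> K" for u v
      using F(2)[of u v] that L(1) K(1) by blast
    have g_K: "g t v \<in> K" "\<phi> (g t v) = \<phi> v \<otimes>\<^bsub>H\<^esub> t" if "v \<in> K" for v using g[OF t] that by auto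
    have one: "\<psi> u \<otimes>\<^bsub>G\<^esub> \<one>\<^bsub>G\<^esub> = \<psi> u" if "u \<in> L" for u
      using bij_betwE[OF \<psi>] that G(1) by (simp add: group.is_monoid monoid.r_one)
    have "?acts (\<one>\<^bsub>G\<^esub>, t) F"
    proof (intro conjI ballI subsetI)
      fix w assume "w \<in> F ` ?LK"
      then obtain u v where "u \<in> L" "v \<in> K" "w = u @ g t v" using F_append by auto
      then show "w \<in> ?LK" using g_K(1) by blast
    next
      fix w assume "w \<in> ?LK"
      then show "\<theta> (F w) = \<theta> w \<otimes>\<^bsub>G \<times>\<times> H\<^esub> (\<one>\<^bsub>G\<^esub>, t)" by (auto simp: F_append \<theta>_append g_K one)
    qed (rule F(1))
    then show ?thesis by (rule exI[of "?acts (\<one>\<^bsub>G\<^esub>, t)" F])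
  qed
  let ?U = "(\<lambda>s. (s, \<one>\<^bsub>H\<^esub>)) ` S \<union> Pair \<one>\<^bsub>G\<^esub> ` T"
  have "\<forall>z \<in> ?U. \<exists>F. ?acts z F"
    by (rule ballI, elim UnE imageE) (simp_all only: first second)
  then obtain F where F: "\<forall>z \<in> ?U. ?acts z (F z)" by (rule bchoice[THEN exE])
  have "semigroup_generators (G \<times>\<times> H) ?U" by (rule semigroup_generators_DirProd[OF G(1) S H(1) T])
  moreover have "finite (A \<union> B)" using finA finB by simp
  moreover have "?LK \<subseteq> lists (A \<union> B)" using L(1) K(1) by fastforce
  moreover have "?LK \<in> \<C>"
    using \<C> finA finB disj L K unfolding closed_under_disjoint_concat_def by blast
  moreover have "bij_betw \<theta> ?LK (carrier (G \<times>\<times> H))" using \<theta> by simp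
  ultimately have "cayley_representation \<C> (G \<times>\<times> H) ?U (A \<union> B) ?LK \<theta> F"
    unfolding cayley_representation_def using F by (intro conjI)
  moreover have "group (G \<times>\<times> H)" using G(1) H(1) by (rule DirProd_group)
  ultimately show ?thesis unfolding cayley_pf_linear_time_iff by blast
qed

lemma disjoint_copy_exists:
  assumes "infinite (UNIV :: 's set)" and "finite (A :: 's set)" and "finite (B :: 's set)"
  obtains B' \<xi> where "finite B'" and "A \<inter> B' = {}" and "bij_betw \<xi> B B'"
proof -
  have "infinite (UNIV - A)" using assms(1,2) by (simp add: Diff_infinite_finite)
  then obtain B' where B': "finite B'" "card B' = card B" "B' \<subseteq> UNIV - A"
    by (meson infinite_arbitrarily_large)
  moreover obtain \<xi> where "bij_betw \<xi> B B'"
    using finite_same_card_bij[OF assms(3) B'(1)] B'(2) by auto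
  ultimately show thesis by (intro that) auto
qed

theorem theorem5:
  fixes \<C> :: "'s list set set"
    and G :: "('a, 'm) monoid_scheme"
    and H :: "('b, 'n) monoid_scheme"
  assumes "infinite (UNIV :: 's set)"
    and "\<C> \<noteq> {}"
    and "closed_under_symbol_change \<C>"
    and "closed_under_disjoint_concat \<C>"
    and "cayley_pf_linear_time \<C> G"
    and "cayley_pf_linear_time \<C> H"
  shows "cayley_pf_linear_time \<C> (G \<times>\<times> H)"
proof -
  obtain S A L \<psi> f where G: "group G" "cayley_representation \<C> G S A L \<psi> f"
    using assms(5) unfolding cayley_pf_linear_time_iff by blast
  obtain T B K \<phi> g where H: "group H" "cayley_representation \<C> H T B K \<phi> g"
    using assms(6) unfolding cayley_pf_linear_time_iff by blast
  have "finite A" "finite B" using G(2) H(2) by (simp_all add: cayley_representation_def)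
  then obtain B' \<xi> where B': "finite B'" "A \<inter> B' = {}" "bij_betw \<xi> B B'"
    by (rule disjoint_copy_exists[OF assms(1)])
  from cayley_representation_rename[OF H(2) assms(3) B'(3,1)]
  show ?thesis by (rule cayley_representation_DirProd[OF assms(4) G H(1) _ B'(2)])
qed

end
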